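(* There is an algorithm that, given a deterministic graph-respecting transducer $T=(Q,q_0,\Omega,S,\Delta,\lambda)$, decides in time $O(|Q||\Omega|)$ whether $T$ is fiber-linear. When the answer is yes, the algorithm reconstructs, up to injective relabeling of the visible states, the unique underlying symbolic DLSL system of $T$, i.e. the injectively labeled symbolic DLSL system with dwell $\mathcal A_T=(S,E,\ell,s_0,d,(g_i)_{i\in S})$, unique up to injective relabeling of the visible states, whose phase-expanded realization is isomorphic to $T$.
   Context: Visible graphs. $S$ is a finite set (visible states), $\Omega$ a finite input alphabet. For a directed graph $(S,E)$, $E\subseteq S\times S$, write $\mathrm{Out}(i)=\{j\in S:(i,j)\in E\}$. With a labeling $\ell:S\to\Sigma$ into a finite alphabet the graph is destination-labeled: each edge $(i,j)$ carries the label $\ell(j)$. It is self-looping if $(i,i)\in E$ for all $i\in S$. It is label-deterministic if for every $i\in S$, $a\in\Sigma$ there is at most one $j\in\mathrm{Out}(i)$ with $\ell(j)=a$. Put $\Sigma_i=\{\ell(j):j\in\mathrm{Out}(i)\}$ and, for $a\in\Sigma_i$, let $\delta(i,a)$ be the unique $j\in\mathrm{Out}(i)$ with $\ell(j)=a$. A symbolic DLSL (destination-labeled self-looping) system with dwell is $\mathcal A=(S,E,\ell,s_0,d,(g_i)_{i\in S})$ where $(S,E,\ell)$ is destination-labeled, self-looping and label-deterministic, $s_0\in S$, $d:S\to\mathbb N_{\ge1}$, $i\mapsto d_i$, and $g_i:\Omega\to\Sigma_i$ for each $i$. It is injectively labeled if $\ell$ is injective. Phase-expanded realization of $\mathcal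 A$: the deterministic transducer with control states $\{(i,r):i\in S,\ 0\le r\le d_i-1\}$, initial state $(s_0,d_{s_0}-1)$, transitions $\Delta((i,r),u)=(i,r-1)$ if $r>0$ and $\Delta((i,0),u)=(j,d_j-1)$ with $j=\delta(i,g_i(u))$, and visible labeling $\lambda(i,r)=i$; the symbol emitted on reading an input is the visible label of the successor state. A graph-respecting (labeled) transducer for a visible graph on $S$ (a directed graph, with out-neighborhoods $\mathrm{Out}(\cdot)$, not required to be self-looping) is a deterministic finite transducer $T=(Q,q_0,\Omega,S,\Delta,\lambda)$ with initial state $q_0$, $\Delta:Q\times\Omega\to Q$, $\lambda:Q\to S$ surjective, and $\lambda(\Delta(q,u))\in\mathrm{Out}(\lambda(q))$ for all $q\in Q$, $u\in\Omega$; it emits the visible label of the successor state. A state $q\in Q$ is forced-hold if there is $q'\in Q$ with $\lambda(q')=\lambda(q)$ and $\Delta(q,u)=q'$ for every $u\in\Omega$; then $\mathrm{hsucc}(q):=q'$. Otherwise $q$ is a decision state. For $i\in S$ let $\mathrm{Fib}(i)=\lambda^{-1}(i)$; the fiber hold graph $H_i$ has vertex set $\mathrm{Fib}(i)$ and an edge $q\to\mathrm{hsucc}(q)$ for each forced-hold $q\in\mathrm{Fib}(i)$. $T$ is fiber-linear if for every $i\in S$: (1) $H_i$ is a directed simple path on the whole of $\mathrm{Fib}(i)$, ending at a unique terminal vertex $p_i$; equivalently, $p_i$ is the unique decision state in $\mathrm{Fib}(i)$, every other state of $\mathrm{Fib}(i)$ is forced-hold, and repeated application of $\mathrm{hsucc}$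 walks through the fiber in a single linear chain until $p_i$ is reached; (2) (reset-on-decision) with $t_i$ the unique initial vertex of the path $H_i$ (so $t_i=p_i$ when $|\mathrm{Fib}(i)|=1$), for every $u\in\Omega$, if $\lambda(\Delta(p_i,u))=j$ then $\Delta(p_i,u)=t_j$. Isomorphism of such transducers: a bijection of control-state sets that sends initial state to initial state, commutes with the transition maps for every input symbol, and preserves visible labels. The reconstruction of $\mathcal A_T$ for fiber-linear $T$ takes $\ell(i)=i$, $d_i=|\mathrm{Fib}(i)|$, $g_i(u)=\lambda(\Delta(p_i,u))$ and $E=\{(i,j):\exists u\in\Omega,\ \lambda(\Delta(p_i,u))=j\}\cup\{(i,i):i\in S\}$. Injective relabeling means replacing the injective labeling $\ell$ by another injective labeling of the visible states, with the values of the maps $g_i$ renamed accordingly.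
   Formalization: The realization of A_T is isomorphic to T if q_0 is the initial vertex t_i of its fiber path, otherwise to T with q_0 moved there (else false); uniqueness of A_T is up to relabeling and deletion of non-loop edges never selected by any g_i, which the realization cannot see; Ω is nonempty. *)

theory Defs
  imports Main
begin

section \<open>Visible graphs and symbolic DLSL systems with dwell\<close>

definition out_nbrs :: "'s set \<Rightarrow> ('s \<times> 's) set \<Rightarrow> 's \<Rightarrow> 's set" where
  "out_nbrs S E i = {j \<in> S. (i, j) \<in> E}"

definition self_looping :: "'s set \<Rightarrow> ('s \<times> 's) set \<Rightarrow> bool" where
  "self_looping S E \<longleftrightarrow> (\<forall>i\<in>S. (i, i) \<in> E)"

definition label_deterministic :: "'s set \<Rightarrow> ('s \<times> 's) set \<Rightarrow> ('s \<Rightarrow> 'l) \<Rightarrow> bool" where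
  "label_deterministic S E l \<longleftrightarrow>
     (\<forall>i\<in>S. \<forall>a. \<exists>\<^sub>\<le>\<^sub>1 j. j \<in> out_nbrs S E i \<and> l j = a)"

text \<open>The input alphabet is not a component of a system; it is passed separately as \<open>\<Omega>\<close>.
  Likewise the label alphabet is not a component: only the labels in \<open>lbl A ` states A\<close>,
  finitely many, matter.\<close>

record ('s, 'o, 'l) dlsl =
  states :: "'s set"
  edges :: "('s \<times> 's) set"
  lbl :: "'s \<Rightarrow> 'l"
  start :: 's
  dwell :: "'s \<Rightarrow> nat"
  select :: "'s \<Rightarrow> 'o \<Rightarrow> 'l"

definition out_labels :: "('s, 'o, 'l) dlsl \<Rightarrow> 's \<Rightarrow> 'l set" where
  "out_labels A i = lbl A ` out_nbrs (states A) (edges A) i"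

definition succ_by_label :: "('s, 'o, 'l) dlsl \<Rightarrow> 's \<Rightarrow> 'l \<Rightarrow> 's" where
  "succ_by_label A i a = (THE j. j \<in> out_nbrs (states A) (edges A) i \<and> lbl A j = a)"

definition symbolic_dlsl :: "'o set \<Rightarrow> ('s, 'o, 'l) dlsl \<Rightarrow> bool" where
  "symbolic_dlsl \<Omega> A \<longleftrightarrow>
     finite (states A) \<and> edges A \<subseteq> states A \<times> states A \<and>
     self_looping (states A) (edges A) \<and>
     label_deterministic (states A) (edges A) (lbl A) \<and>
     start A \<in> states A \<and>
     (\<forall>i\<in>states A. 1 \<le> dwell A i) \<and>
     (\<forall>i\<in>states A. \<forall>u\<in>\<Omega>. select A i u \<in> out_labels A i)"

definition injectively_labeled :: "('s, 'o, 'l) dlsl \<Rightarrow> bool" where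
  "injectively_labeled A \<longleftrightarrow> inj_on (lbl A) (states A)"

text \<open>The functional components of a system are only meaningful on \<open>states A\<close> and
  \<open>\<Omega>\<close>, so they are compared there only.\<close>

definition injective_relabeling ::
    "'o set \<Rightarrow> ('s, 'o, 'l) dlsl \<Rightarrow> ('s, 'o, 'm) dlsl \<Rightarrow> bool" where
  "injective_relabeling \<Omega> A B \<longleftrightarrow>
     states B = states A \<and> edges B = edges A \<and> start B = start A \<and>
     (\<forall>i\<in>states A. dwell B i = dwell A i) \<and>
     (\<exists>\<rho>. bij_betw \<rho> (lbl A ` states A) (lbl B ` states B) \<and>
          (\<forall>i\<in>states A. lbl B i = \<rho> (lbl A i)) \<and>
          (\<forall>i\<in>states A. \<forall>u\<in>\<Omega>. select B i u = \<rho> (select A i u))) \<and>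
     injectively_labeled A \<and> injectively_labeled B"

text \<open>The phase-expanded realization does not see an edge that is neither a self-loop nor ever
  selected; \<open>prune\<close> deletes these edges. Uniqueness of the system underlying a
  transducer can only be meant up to them.\<close>

definition prune :: "'o set \<Rightarrow> ('s, 'o, 'l) dlsl \<Rightarrow> ('s, 'o, 'l) dlsl" where
  "prune \<Omega> A = A\<lparr>edges := {(i, j) \<in> edges A.
      i = j \<or> (\<exists>u\<in>\<Omega>. j = succ_by_label A i (select A i u))}\<rparr>"

definition edge_reduced :: "'o set \<Rightarrow> ('s, 'o, 'l) dlsl \<Rightarrow> bool" where
  "edge_reduced \<Omega> A \<longleftrightarrow> prune \<Omega> A = A"


section \<open>Graph-respecting transducers\<close>

record ('q, 'o, 's) transducer =
  ctrl :: "'q set"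
  init :: 'q
  inputs :: "'o set"
  visible :: "'s set"
  trans :: "'q \<Rightarrow> 'o \<Rightarrow> 'q"
  vis :: "'q \<Rightarrow> 's"

text \<open>An alphabet is nonempty: for an empty one, \<open>hsucc\<close> below would not be well defined.\<close>

definition graph_respecting :: "('s \<times> 's) set \<Rightarrow> ('q, 'o, 's) transducer \<Rightarrow> bool" where
  "graph_respecting V T \<longleftrightarrow>
     finite (visible T) \<and> V \<subseteq> visible T \<times> visible T \<and>
     finite (ctrl T) \<and> init T \<in> ctrl T \<and>
     finite (inputs T) \<and> inputs T \<noteq> {} \<and>
     (\<forall>q\<in>ctrl T. \<forall>u\<in>inputs T. trans T q u \<in> ctrl T) \<and>
     vis T ` ctrl T = visible T \<and>
     (\<forall>q\<in>ctrl T. \<forall>u\<in>inputs T. vis T (trans T q u) \<in> out_nbrs (visible T) V (vis T q))"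

definition transducer_iso :: "('q, 'o, 's) transducer \<Rightarrow> ('r, 'o, 's) transducer \<Rightarrow> bool" where
  "transducer_iso T U \<longleftrightarrow>
     inputs U = inputs T \<and> visible U = visible T \<and>
     (\<exists>f. bij_betw f (ctrl T) (ctrl U) \<and> f (init T) = init U \<and>
          (\<forall>q\<in>ctrl T. \<forall>u\<in>inputs T. f (trans T q u) = trans U (f q) u) \<and>
          (\<forall>q\<in>ctrl T. vis U (f q) = vis T q))"

definition phase_expanded :: "'o set \<Rightarrow> ('s, 'o, 'l) dlsl \<Rightarrow> ('s \<times> nat, 'o, 's) transducer" where
  "phase_expanded \<Omega> A =
     \<lparr>ctrl = {(i, r). i \<in> states A \<and> r \<le> dwell A i - 1},
      init = (start A, dwell A (start A) - 1),
      inputs = \<Omega>,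
      visible = states A,
      trans = (\<lambda>(i, r) u. if r > 0 then (i, r - 1)
                 else let j = succ_by_label A i (select A i u) in (j, dwell A j - 1)),
      vis = fst\<rparr>"


section \<open>Fiber-linearity and reconstruction\<close>

definition holds_to :: "('q, 'o, 's) transducer \<Rightarrow> 'q \<Rightarrow> 'q \<Rightarrow> bool" where
  "holds_to T q q' \<longleftrightarrow>
     q' \<in> ctrl T \<and> vis T q' = vis T q \<and> (\<forall>u\<in>inputs T. trans T q u = q')"

definition forced_hold :: "('q, 'o, 's) transducer \<Rightarrow> 'q \<Rightarrow> bool" where
  "forced_hold T q \<longleftrightarrow> (\<exists>q'. holds_to T q q')"

definition hsucc :: "('q, 'o, 's) transducer \<Rightarrow> 'q \<Rightarrow> 'q" where
  "hsucc T q = (THE q'. holds_to T q q')"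

definition fiber :: "('q, 'o, 's) transducer \<Rightarrow> 's \<Rightarrow> 'q set" where
  "fiber T i = {q \<in> ctrl T. vis T q = i}"

definition hold_graph :: "('q, 'o, 's) transducer \<Rightarrow> 's \<Rightarrow> ('q \<times> 'q) set" where
  "hold_graph T i = {(q, hsucc T q) |q. q \<in> fiber T i \<and> forced_hold T q}"

definition simple_path_graph :: "'v set \<Rightarrow> ('v \<times> 'v) set \<Rightarrow> bool" where
  "simple_path_graph V E \<longleftrightarrow>
     (\<exists>vs. vs \<noteq> [] \<and> distinct vs \<and> set vs = V \<and>
           E = {(vs ! k, vs ! Suc k) |k. Suc k < length vs})"

definition terminal :: "('q, 'o, 's) transducer \<Rightarrow> 's \<Rightarrow> 'q" where
  "terminal T i = (THE p. p \<in> fiber T i \<and> (\<forall>q. (p, q) \<notin> hold_graph T i))"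

definition entry :: "('q, 'o, 's) transducer \<Rightarrow> 's \<Rightarrow> 'q" where
  "entry T i = (THE t. t \<in> fiber T i \<and> (\<forall>q. (q, t) \<notin> hold_graph T i))"

definition fiber_linear :: "('q, 'o, 's) transducer \<Rightarrow> bool" where
  "fiber_linear T \<longleftrightarrow>
     (\<forall>i\<in>visible T.
        simple_path_graph (fiber T i) (hold_graph T i) \<and>
        (\<forall>u\<in>inputs T. \<forall>j\<in>visible T. vis T (trans T (terminal T i) u) = j \<longrightarrow>
           trans T (terminal T i) u = entry T j))"

definition reconstruct :: "('q, 'o, 's) transducer \<Rightarrow> ('s, 'o, 's) dlsl" where
  "reconstruct T =
     \<lparr>states = visible T,
      edges = {(i, j). i \<in> visible T \<and> j \<in> visible T \<and>
                  (\<exists>u\<in>inputs T. vis T (trans T (terminal T i) u) = j)}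
              \<union> {(i, i) |i. i \<in> visible T},
      lbl = (\<lambda>i. i),
      start = vis T (init T),
      dwell = (\<lambda>i. card (fiber T i)),
      select = (\<lambda>i u. vis T (trans T (terminal T i) u))\<rparr>"

text \<open>Fiber-linearity does not constrain the initial state, whereas a phase-expanded realization
  starts at the beginning of a chain. \<open>at_entry T\<close> is \<open>T\<close> started at the initial
  vertex of the chain through \<open>init T\<close>.\<close>

definition at_entry :: "('q, 'o, 's) transducer \<Rightarrow> ('q, 'o, 's) transducer" where
  "at_entry T = T\<lparr>init := entry T (vis T (init T))\<rparr>"


section \<open>Machine model\<close>

text \<open>A unit-cost random access machine with finitely many registers and arrays of natural
  numbers (a program mentions only finitely many names), programmed in a structured language.
  The only arithmetic is the successor, so a run of \<open>t\<close> steps produces no number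
  exceeding by more than \<open>t\<close> all numbers in the initial state and in the program. Hence
  unit cost cannot be abused to compute with long numbers, and a linear time bound here is one
  for word RAMs with words of logarithmic length as well.\<close>

datatype operand = Const nat | Reg string

datatype test = Less operand operand | Equal operand operand

datatype prog =
    Skip
  | Assign string operand
  | Succ string operand
  | Load string string operand    \<comment> \<open>\<open>Load r a i\<close>: \<open>r := a[i]\<close>\<close>
  | Store string operand operand  \<comment> \<open>\<open>Store a i v\<close>: \<open>a[i] := v\<close>\<close>
  | Seq prog prog
  | Cond test prog prog
  | While test prog

record store =
  regs :: "string \<Rightarrow> nat"
  arrs :: "string \<Rightarrow> nat \<Rightarrow> nat"

fun val :: "store \<Rightarrow> operand \<Rightarrow> nat" where
  "val s (Const n) = n"
| "val s (Reg r) = regs s r"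

fun test_val :: "store \<Rightarrow> test \<Rightarrow> bool" where
  "test_val s (Less x y) \<longleftrightarrow> val s x < val s y"
| "test_val s (Equal x y) \<longleftrightarrow> val s x = val s y"

definition set_reg :: "string \<Rightarrow> nat \<Rightarrow> store \<Rightarrow> store" where
  "set_reg r v s = s\<lparr>regs := (regs s)(r := v)\<rparr>"

definition set_arr :: "string \<Rightarrow> nat \<Rightarrow> nat \<Rightarrow> store \<Rightarrow> store" where
  "set_arr a i v s = s\<lparr>arrs := (arrs s)(a := (arrs s a)(i := v))\<rparr>"

text \<open>\<open>runs P s t s'\<close>: started in \<open>s\<close>, the program \<open>P\<close> halts in \<open>s'\<close> after
  exactly \<open>t\<close> steps.\<close>

inductive runs :: "prog \<Rightarrow> store \<Rightarrow> nat \<Rightarrow> store \<Rightarrow> bool" where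
  skip: "runs Skip s 1 s"
| assign: "runs (Assign r x) s 1 (set_reg r (val s x) s)"
| succ: "runs (Succ r x) s 1 (set_reg r (Suc (val s x)) s)"
| load: "runs (Load r a x) s 1 (set_reg r (arrs s a (val s x)) s)"
| store: "runs (Store a x y) s 1 (set_arr a (val s x) (val s y) s)"
| seq: "runs P s m s' \<Longrightarrow> runs P' s' n s'' \<Longrightarrow> runs (Seq P P') s (m + n) s''"
| cond_true: "test_val s b \<Longrightarrow> runs P s n s' \<Longrightarrow> runs (Cond b P P') s (Suc n) s'"
| cond_false: "\<not> test_val s b \<Longrightarrow> runs P' s n s' \<Longrightarrow> runs (Cond b P P') s (Suc n) s'"
| while_true: "test_val s b \<Longrightarrow> runs P s m s' \<Longrightarrow> runs (While b P) s' n s'' \<Longrightarrow>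
    runs (While b P) s (Suc (m + n)) s''"
| while_false: "\<not> test_val s b \<Longrightarrow> runs (While b P) s 1 s"

inductive_cases runs_elims:
  "runs Skip s t s'" "runs (Assign r x) s t s'" "runs (Succ r x) s t s'"
  "runs (Load r a x) s t s'" "runs (Store a x y) s t s'" "runs (Seq P P') s t s'"
  "runs (Cond b P P') s t s'"

inductive_cases while_elim: "runs (While b P) s t s'"

lemma runs_deterministic:
  "runs P s t s' \<Longrightarrow> runs P s u s'' \<Longrightarrow> u = t \<and> s'' = s'"
proof (induction arbitrary: u s'' rule: runs.induct)
  case (seq P s m s1 P' n s2)
  from seq.prems show ?case by (rule runs_elims(6)) (use seq.IH in blast)
next
  case (cond_true s b P n s1 P')
  from cond_true.prems show ?case by (rule runs_elims(7)) (use cond_true in blast)+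
next
  case (cond_false s b P' n s1 P)
  from cond_false.prems show ?case by (rule runs_elims(7)) (use cond_false in blast)+
next
  case (while_true s b P m s1 n s2)
  from while_true.prems show ?case by (rule while_elim) (use while_true in blast)+
next
  case (while_false s b P)
  from while_false.prems show ?case by (rule while_elim) (use while_false.hyps in simp_all)
qed (erule runs_elims, simp)+

text \<open>Inputs of the algorithm: control states, input symbols and visible states are numbered
  from 0; the transition table is stored in row-major order.\<close>

definition numbered :: "(nat, nat, nat) transducer \<Rightarrow> bool" where
  "numbered T \<longleftrightarrow> ctrl T = {..<card (ctrl T)} \<and> inputs T = {..<card (inputs T)} \<and>
                  visible T = {..<card (visible T)}"

definition input_store :: "(nat, nat, nat) transducer \<Rightarrow> store" where
  "input_store T =
     \<lparr>regs = (\<lambda>_. 0)(''nQ'' := card (ctrl T), ''nO'' := card (inputs T),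
                      ''nS'' := card (visible T), ''q0'' := init T),
      arrs = (\<lambda>_ _. 0)
        (''delta'' := (\<lambda>x. if x < card (ctrl T) * card (inputs T)
                           then trans T (x div card (inputs T)) (x mod card (inputs T)) else 0),
         ''lambda'' := (\<lambda>q. if q < card (ctrl T) then vis T q else 0))\<rparr>"

text \<open>The system held by the store at the end of a run: the selection maps are a table in
  row-major order, the edge set is given as a list of \<open>nE\<close> pairs, possibly repeating.\<close>

definition output_system :: "store \<Rightarrow> (nat, nat, nat) dlsl" where
  "output_system s =
     \<lparr>states = {..<regs s ''nS''},
      edges = {(arrs s ''src'' e, arrs s ''dst'' e) |e. e < regs s ''nE''},
      lbl = arrs s ''label'',
      start = regs s ''s0'',
      dwell = arrs s ''d'',
      select = (\<lambda>i u. arrs s ''g'' (i * regs s ''nO'' + u))\<rparr>"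

definition answers_yes :: "store \<Rightarrow> bool" where
  "answers_yes s \<longleftrightarrow> regs s ''answer'' = 1"

end

theory Submission
  imports Defs
begin

text \<open>A fiber is traversed backwards: starting from a decision state, repeatedly pick a state that
  holds to the current one. Such a chain never repeats, since a repetition would make its last
  state forced-hold, and the hold graph of a fiber is a simple path exactly if a maximal chain
  has as many states as the fiber. The fibers partition the control states, so all hold graphs are
  simple paths if and only if the lengths of the chains, one for each fiber, add up to \<open>|Q|\<close>; and
  whether they do or not, walking all chains takes at most \<open>|Q|\<close> steps.

  A system whose realization is isomorphic to a fiber-linear transducer can be read off it: the
  dwell time of a visible state is the size of its fiber, and the states of positive phase are
  forced-hold, so that the state of phase 0 corresponds to the terminal vertex of the fiber.\<close>

section \<open>Chains of forced holds\<close>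

text \<open>A forward walk along forced holds may be trapped in a cycle, hence the direction. The
  price is that a state may have several predecessors and a fiber several decision states; the
  tables keep one arbitrary candidate each. No choice has to be justified: in a fiber that is a path
  there is nothing to choose, and in any other fiber every chain is too short. Reset-on-decision is
  tested only once all fibers are known to be paths, because before that terminal and initial
  vertices need not be well defined. The machine cannot multiply, so positions in the transition
  table are carried along by counters, and the start of each row is saved for the later visit to the
  rows of the terminal vertices.\<close>

locale visible_graph_transducer =
  fixes V :: "('s \<times> 's) set" and T :: "('q, 'o, 's) transducer"
  assumes graph_respecting: "graph_respecting V T"
begin

lemma finite_ctrl: "finite (ctrl T)" and finite_visible: "finite (visible T)"
  and inputs_nonempty: "inputs T \<noteq> {}" and init_in: "init T \<in> ctrl T"
  and vis_image: "vis T ` ctrl T = visible T"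
  using graph_respecting by (auto simp: graph_respecting_def)

lemma trans_in: "q \<in> ctrl T \<Longrightarrow> u \<in> inputs T \<Longrightarrow> trans T q u \<in> ctrl T"
  using graph_respecting by (auto simp: graph_respecting_def)

lemma vis_in: "q \<in> ctrl T \<Longrightarrow> vis T q \<in> visible T"
  using vis_image by blast

lemma finite_fiber: "finite (fiber T i)"
  by (simp add: fiber_def finite_ctrl)

lemma fiber_nonempty: "i \<in> visible T \<Longrightarrow> fiber T i \<noteq> {}"
  using vis_image by (force simp: fiber_def)

lemma fiber_ctrl: "q \<in> fiber T i \<Longrightarrow> q \<in> ctrl T" and fiber_vis: "q \<in> fiber T i \<Longrightarrow> vis T q = i"
  by (auto simp: fiber_def)

lemma sum_card_fiber: "(\<Sum>i\<in>visible T. card (fiber T i)) = card (ctrl T)"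
proof -
  have "ctrl T = (\<Union>i\<in>visible T. fiber T i)"
    using vis_in by (auto simp: fiber_def)
  moreover have "card (\<Union>i\<in>visible T. fiber T i) = (\<Sum>i\<in>visible T. card (fiber T i))"
    by (rule card_UN_disjoint) (auto simp: finite_visible finite_fiber, auto simp: fiber_def)
  ultimately show ?thesis by simp
qed

text \<open>The alphabet is nonempty, so both targets are the successor under one and the same
  input.\<close>

lemma holds_to_unique: "holds_to T q q' \<Longrightarrow> holds_to T q q'' \<Longrightarrow> q' = q''"
  using inputs_nonempty by (auto simp: holds_to_def)

lemma hsucc_eq: "holds_to T q q' \<Longrightarrow> hsucc T q = q'"
  unfolding hsucc_def by (rule the_equality) (auto intro: holds_to_unique)

lemma holds_to_fiber_back: "holds_to T q q' \<Longrightarrow> q \<in> ctrl T \<Longrightarrow> q' \<in> fiber T i \<Longrightarrow> q \<in> fiber T i"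
  by (auto simp: holds_to_def fiber_def)

lemma hold_graph_iff: "(q, q') \<in> hold_graph T i \<longleftrightarrow> q \<in> fiber T i \<and> holds_to T q q'"
  unfolding hold_graph_def forced_hold_def using hsucc_eq by blast

definition hold_chain :: "'s \<Rightarrow> 'q list \<Rightarrow> bool" where
  "hold_chain i vs \<longleftrightarrow> set vs \<subseteq> fiber T i \<and>
     (\<forall>k. Suc k < length vs \<longrightarrow> holds_to T (vs ! k) (vs ! Suc k)) \<and>
     (vs \<noteq> [] \<longrightarrow> \<not> forced_hold T (last vs))"

text \<open>Maximality concerns the head only: no backward extension exists. Another decision state
  or other predecessors might have led to a longer chain.\<close>

definition maximal_chain :: "'s \<Rightarrow> 'q list \<Rightarrow> bool" where
  "maximal_chain i vs \<longleftrightarrow> hold_chain i vs \<and>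
     (vs = [] \<longrightarrow> (\<forall>q\<in>fiber T i. forced_hold T q)) \<and>
     (vs \<noteq> [] \<longrightarrow> (\<forall>q\<in>ctrl T. \<not> holds_to T q (hd vs)))"

lemma hold_chain_Nil: "hold_chain i []"
  by (simp add: hold_chain_def)

lemma hold_chain_singleton: "q \<in> fiber T i \<Longrightarrow> \<not> forced_hold T q \<Longrightarrow> hold_chain i [q]"
  by (simp add: hold_chain_def)

lemma hold_chain_Cons:
  assumes "hold_chain i vs" "vs \<noteq> []" "q \<in> ctrl T" "holds_to T q (hd vs)"
  shows "hold_chain i (q # vs)"
proof -
  have "q \<in> fiber T i"
    using assms holds_to_fiber_back[OF assms(4,3)] hd_in_set[OF assms(2)]
    unfolding hold_chain_def by blast
  moreover have "holds_to T ((q # vs) ! k) ((q # vs) ! Suc k)" if "Suc k < length (q # vs)" for k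
    using assms that by (cases k) (auto simp: hold_chain_def hd_conv_nth)
  ultimately show ?thesis
    using assms by (auto simp: hold_chain_def)
qed

text \<open>A repetition would shift along the chain up to its last state, which would then be
  forced-hold.\<close>

lemma hold_chain_distinct:
  assumes "hold_chain i vs"
  shows "distinct vs"
proof (rule ccontr)
  assume "\<not> distinct vs"
  then obtain a b where "a < length vs" "b < length vs" "a \<noteq> b" "vs ! a = vs ! b"
    by (auto simp: distinct_conv_nth)
  then obtain a b where ab: "a < b" "b < length vs" "vs ! a = vs ! b"
    by (metis nat_neq_iff)
  have step: "Suc k < length vs \<Longrightarrow> holds_to T (vs ! k) (vs ! Suc k)" for k
    using assms by (simp add: hold_chain_def)
  have shift: "b + j < length vs \<Longrightarrow> vs ! (a + j) = vs ! (b + j)" for j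
  proof (induction j)
    case (Suc j)
    then have "Suc (a + j) < length vs"
      using ab by simp
    moreover have "Suc (b + j) < length vs"
      using Suc.prems by simp
    ultimately have "holds_to T (vs ! (a + j)) (vs ! Suc (a + j))"
      and "holds_to T (vs ! (b + j)) (vs ! Suc (b + j))"
      by (simp_all add: step)
    with Suc show ?case
      using holds_to_unique by simp
  qed (use ab in simp)
  obtain j where j: "length vs = Suc (b + j)"
    using ab less_iff_Suc_add by auto
  then have "vs ! (a + j) = last vs"
    using shift[of j] last_conv_nth[of vs] by fastforce
  moreover have "holds_to T (vs ! (a + j)) (vs ! Suc (a + j))"
    using step j ab by simp
  ultimately have "forced_hold T (last vs)"
    by (auto simp: forced_hold_def)
  moreover have "vs \<noteq> []"
    using ab by auto
  ultimately show False
    using assms by (simp add: hold_chain_def)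
qed

text \<open>Distinctness turns into termination: the fiber size bounds the number of backward
  steps.\<close>

lemma hold_chain_length_le: "hold_chain i vs \<Longrightarrow> length vs \<le> card (fiber T i)"
  using hold_chain_distinct[of i vs] card_mono[OF finite_fiber, of "set vs" i]
  by (simp add: distinct_card hold_chain_def)

text \<open>Holds are functional, so each state before the last contributes exactly the edge to its
  neighbour in the list; the last one, a decision state, contributes none.\<close>

lemma hold_chain_full:
  assumes "hold_chain i vs" "set vs = fiber T i"
  shows "hold_graph T i = {(vs ! k, vs ! Suc k) |k. Suc k < length vs}"
proof (intro set_eqI iffI; clarify)
  fix q q' assume "(q, q') \<in> hold_graph T i"
  then have q: "q \<in> set vs" "holds_to T q q'"
    using assms by (auto simp: hold_graph_iff)
  then obtain k where k: "k < length vs" "q = vs ! k"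
    by (auto simp: in_set_conv_nth)
  have "Suc k < length vs"
  proof (rule ccontr)
    assume "\<not> Suc k < length vs"
    with k have "k = length vs - 1" "vs \<noteq> []"
      by auto
    with k have "q = last vs" "vs \<noteq> []"
      by (simp_all add: last_conv_nth)
    then show False
      using q assms by (auto simp: hold_chain_def forced_hold_def)
  qed
  moreover from this have "q' = vs ! Suc k"
    using q k assms(1) holds_to_unique[OF q(2), of "vs ! Suc k"] by (simp add: hold_chain_def)
  ultimately show "\<exists>k. (q, q') = (vs ! k, vs ! Suc k) \<and> Suc k < length vs"
    using k by auto
next
  fix q q' k assume "Suc k < length vs"
  then show "(vs ! k, vs ! Suc k) \<in> hold_graph T i"
    using assms by (auto simp: hold_graph_iff hold_chain_def)
qed

text \<open>Trades an equation between edge sets for local conditions on consecutive states, which a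
  walk can maintain.\<close>

lemma full_chain_iff_path:
  "(vs \<noteq> [] \<and> hold_chain i vs \<and> set vs = fiber T i) \<longleftrightarrow>
     (vs \<noteq> [] \<and> distinct vs \<and> set vs = fiber T i \<and>
      hold_graph T i = {(vs ! k, vs ! Suc k) |k. Suc k < length vs})" (is "?L \<longleftrightarrow> ?R")
proof
  assume ?L then show ?R
    using hold_chain_full[of i vs] hold_chain_distinct[of i vs] by simp
next
  assume R: ?R
  \<comment> \<open>An edge leaving the last vertex would, by distinctness, start at the last index,
    but all listed edges start before it.\<close>
  have "\<not> forced_hold T (last vs)"
  proof
    assume "forced_hold T (last vs)"
    then obtain q' where "(last vs, q') \<in> hold_graph T i"
      using R last_in_set[of vs] by (metis forced_hold_def hold_graph_iff)
    then obtain k where k: "last vs = vs ! k" "Suc k < length vs"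
      using R by auto
    then have "k = length vs - 1"
      using R by (auto simp: last_conv_nth nth_eq_iff_index_eq)
    with k show False by simp
  qed
  moreover have "holds_to T (vs ! k) (vs ! Suc k)" if "Suc k < length vs" for k
  proof -
    have "(vs ! k, vs ! Suc k) \<in> hold_graph T i"
      using R that by blast
    then show ?thesis by (simp add: hold_graph_iff)
  qed
  ultimately show ?L
    using R by (auto simp: hold_chain_def)
qed

lemma simple_path_iff_chain:
  "simple_path_graph (fiber T i) (hold_graph T i) \<longleftrightarrow>
     (\<exists>vs. vs \<noteq> [] \<and> hold_chain i vs \<and> set vs = fiber T i)"
  unfolding full_chain_iff_path simple_path_graph_def ..

lemma terminal_eq_last:
  assumes "vs \<noteq> []" "hold_chain i vs" "set vs = fiber T i"
  shows "terminal T i = last vs"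
  unfolding terminal_def
proof (rule the_equality)
  show "last vs \<in> fiber T i \<and> (\<forall>q. (last vs, q) \<notin> hold_graph T i)"
    using assms by (auto simp: hold_graph_iff hold_chain_def forced_hold_def)
next
  fix p assume p: "p \<in> fiber T i \<and> (\<forall>q. (p, q) \<notin> hold_graph T i)"
  then obtain k where k: "k < length vs" "p = vs ! k"
    using assms by (metis in_set_conv_nth)
  have "\<not> Suc k < length vs"
    using p k hold_chain_full[OF assms(2,3)] by auto
  with k have "k = length vs - 1"
    by simp
  then show "p = last vs"
    using k assms by (simp add: last_conv_nth)
qed

lemma entry_eq_hd:
  assumes "vs \<noteq> []" "hold_chain i vs" "set vs = fiber T i"
  shows "entry T i = hd vs"
  unfolding entry_def
proof (rule the_equality)
  have "(q, hd vs) \<notin> hold_graph T i" for q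
    unfolding hold_chain_full[OF assms(2,3)]
    using hold_chain_distinct[OF assms(2)] assms(1)
    by (auto simp: hd_conv_nth nth_eq_iff_index_eq)
  then show "hd vs \<in> fiber T i \<and> (\<forall>q. (q, hd vs) \<notin> hold_graph T i)"
    using assms by auto
next
  fix t assume t: "t \<in> fiber T i \<and> (\<forall>q. (q, t) \<notin> hold_graph T i)"
  then obtain k where k: "k < length vs" "t = vs ! k"
    using assms by (metis in_set_conv_nth)
  have "k = 0"
    using t k hold_chain_full[OF assms(2,3)] by (cases k) auto
  then show "t = hd vs"
    using k assms by (simp add: hd_conv_nth)
qed

lemma card_fiber_eq_length:
  "hold_chain i vs \<Longrightarrow> set vs = fiber T i \<Longrightarrow> card (fiber T i) = length vs"
  using hold_chain_distinct distinct_card by metis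

text \<open>The head of a maximal chain has no predecessor, so if the fiber is a path, this head is
  the first vertex of the path; determinism of holds then drives the chain along the whole path.
  Conversely, a distinct list inside the fiber with as many entries as the fiber exhausts
  it.\<close>

lemma maximal_chain_path_iff:
  assumes i: "i \<in> visible T" and vs: "maximal_chain i vs"
  shows "simple_path_graph (fiber T i) (hold_graph T i) \<longleftrightarrow> length vs = card (fiber T i)"
    and "length vs = card (fiber T i) \<Longrightarrow> vs \<noteq> [] \<and> hold_chain i vs \<and> set vs = fiber T i"
proof -
  have c: "hold_chain i vs"
    using vs by (simp add: maximal_chain_def)
  show full: "vs \<noteq> [] \<and> hold_chain i vs \<and> set vs = fiber T i" if "length vs = card (fiber T i)"
  proof -
    have "set vs = fiber T i"
      using that c hold_chain_distinct[OF c]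
      by (intro card_subset_eq finite_fiber) (auto simp: hold_chain_def distinct_card)
    with c show ?thesis
      using fiber_nonempty[OF i] by auto
  qed
  show "simple_path_graph (fiber T i) (hold_graph T i) \<longleftrightarrow> length vs = card (fiber T i)"
  proof
    assume "simple_path_graph (fiber T i) (hold_graph T i)"
    then obtain ws where ws: "ws \<noteq> []" "hold_chain i ws" "set ws = fiber T i"
      unfolding simple_path_iff_chain by blast
    have ne: "vs \<noteq> []"
    proof
      assume "vs = []"
      moreover have "last ws \<in> fiber T i" "\<not> forced_hold T (last ws)"
        using ws last_in_set[of ws] by (simp_all add: hold_chain_def)
      ultimately show False
        using vs by (simp add: maximal_chain_def)
    qed
    \<comment> \<open>The chain cannot stop early: it ends at a decision state, and
      \<open>ws ! k\<close> is forced-hold as long as \<open>ws\<close> goes on.\<close>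
    have "ws ! k \<in> set vs" if "k < length ws" for k
      using that
    proof (induction k)
      case 0
      have "hd vs \<in> set ws"
        using c ne hd_in_set[of vs] ws(3) unfolding hold_chain_def by blast
      then obtain k where k: "k < length ws" "hd vs = ws ! k"
        by (auto simp: in_set_conv_nth)
      have "k = 0"
      proof (cases k)
        case (Suc k')
        then have "holds_to T (ws ! k') (hd vs)" "ws ! k' \<in> set ws"
          using ws(2) k by (simp_all add: hold_chain_def)
        then show ?thesis
          using vs ne ws(3) fiber_ctrl unfolding maximal_chain_def by blast
      qed simp
      then show ?case using k hd_in_set[OF ne] by simp
    next
      case (Suc k)
      then have "ws ! k \<in> set vs"
        by simp
      then obtain m where m: "m < length vs" "ws ! k = vs ! m"
        by (auto simp: in_set_conv_nth)
      have h: "holds_to T (ws ! k) (ws ! Suc k)"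
        using ws(2) Suc.prems by (simp add: hold_chain_def)
      then have "vs ! m \<noteq> last vs"
        using m c ne unfolding hold_chain_def forced_hold_def by auto
      then have "Suc m < length vs"
        using m ne last_conv_nth[of vs] by (cases "m = length vs - 1") simp_all
      moreover from this have "vs ! Suc m = ws ! Suc k"
        using c m holds_to_unique[OF h, of "vs ! Suc m"] by (simp add: hold_chain_def)
      ultimately show ?case using nth_mem[of "Suc m" vs] by simp
    qed
    then have "set ws \<subseteq> set vs"
      by (auto simp: in_set_conv_nth)
    then have "set vs = fiber T i"
      using c ws(3) by (simp add: hold_chain_def)
    then show "length vs = card (fiber T i)"
      using card_fiber_eq_length[OF c] by simp
  next
    assume "length vs = card (fiber T i)"
    then show "simple_path_graph (fiber T i) (hold_graph T i)"
      unfolding simple_path_iff_chain by (intro exI[of _ vs] full)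
  qed
qed

lemma
  assumes "simple_path_graph (fiber T i) (hold_graph T i)"
  shows terminal_in_fiber: "terminal T i \<in> fiber T i"
    and terminal_not_forced_hold: "\<not> forced_hold T (terminal T i)"
    and terminal_unique: "q \<in> fiber T i \<Longrightarrow> \<not> forced_hold T q \<Longrightarrow> q = terminal T i"
proof -
  obtain vs where vs: "vs \<noteq> []" "hold_chain i vs" "set vs = fiber T i"
    using assms by (auto simp: simple_path_iff_chain)
  show "terminal T i \<in> fiber T i" "\<not> forced_hold T (terminal T i)"
    using vs(2) last_in_set[OF vs(1)] vs(1) by (simp_all add: terminal_eq_last[OF vs] hold_chain_def vs(3))
  assume "q \<in> fiber T i" "\<not> forced_hold T q"
  then have "q \<in> set vs"
    by (simp add: vs(3))
  then obtain k where k: "k < length vs" "q = vs ! k"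
    by (auto simp: in_set_conv_nth)
  have "\<not> Suc k < length vs"
    using vs(2) k \<open>\<not> forced_hold T q\<close> by (auto simp: hold_chain_def forced_hold_def)
  with k have "k = length vs - 1"
    by simp
  with k vs show "q = terminal T i"
    by (simp add: terminal_eq_last[OF vs] last_conv_nth)
qed

end

section \<open>The system underlying a fiber-linear transducer\<close>

locale fiber_linear_transducer = visible_graph_transducer V T
  for V :: "('s \<times> 's) set" and T :: "('q, 'o, 's) transducer" +
  assumes fiber_linear: "fiber_linear T"
begin

definition path :: "'s \<Rightarrow> 'q list" where
  "path i = (SOME vs. vs \<noteq> [] \<and> hold_chain i vs \<and> set vs = fiber T i)"

lemma path: "path i \<noteq> []" "hold_chain i (path i)" "set (path i) = fiber T i" if "i \<in> visible T"
proof -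
  have "\<exists>vs. vs \<noteq> [] \<and> hold_chain i vs \<and> set vs = fiber T i"
    using fiber_linear that by (auto simp: fiber_linear_def simple_path_iff_chain)
  from someI_ex[OF this]
  show "path i \<noteq> []" "hold_chain i (path i)" "set (path i) = fiber T i"
    by (simp_all add: path_def)
qed

lemma terminal_eq: "i \<in> visible T \<Longrightarrow> terminal T i = last (path i)"
  and entry_eq: "i \<in> visible T \<Longrightarrow> entry T i = hd (path i)"
  and card_fiber: "i \<in> visible T \<Longrightarrow> card (fiber T i) = length (path i)"
  by (simp_all add: path terminal_eq_last[OF path] entry_eq_hd[OF path]
      card_fiber_eq_length[OF path(2,3)])

lemma simple_path: "i \<in> visible T \<Longrightarrow> simple_path_graph (fiber T i) (hold_graph T i)"
  using fiber_linear by (simp add: fiber_linear_def)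

lemmas terminal_in = terminal_in_fiber[OF simple_path]
  and terminal_decision = terminal_not_forced_hold[OF simple_path]

lemma entry_in: "i \<in> visible T \<Longrightarrow> entry T i \<in> fiber T i"
  using path(1,3) hd_in_set[of "path i"] entry_eq by simp

lemma vis_trans_terminal_in:
  "i \<in> visible T \<Longrightarrow> u \<in> inputs T \<Longrightarrow> vis T (trans T (terminal T i) u) \<in> visible T"
  using terminal_in fiber_ctrl trans_in vis_in by blast

lemma trans_terminal:
  "i \<in> visible T \<Longrightarrow> u \<in> inputs T \<Longrightarrow>
     trans T (terminal T i) u = entry T (vis T (trans T (terminal T i) u))"
  using fiber_linear vis_trans_terminal_in by (simp add: fiber_linear_def)

lemma succ_by_label_reconstruct:
  assumes "i \<in> visible T" "u \<in> inputs T"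
  shows "succ_by_label (reconstruct T) i (select (reconstruct T) i u) =
     vis T (trans T (terminal T i) u)"
  unfolding succ_by_label_def using assms vis_trans_terminal_in[OF assms]
  by (intro the_equality) (auto simp: reconstruct_def out_nbrs_def)

lemma symbolic_dlsl_reconstruct: "symbolic_dlsl (inputs T) (reconstruct T)"
proof -
  have "1 \<le> card (fiber T i)" if "i \<in> visible T" for i
    using that path(1) by (simp add: card_fiber Suc_leI)
  then show ?thesis
    using vis_trans_terminal_in vis_in[OF init_in]
    by (auto simp: symbolic_dlsl_def reconstruct_def finite_visible self_looping_def
        label_deterministic_def Uniq_def out_labels_def out_nbrs_def)
qed

lemma injectively_labeled_reconstruct: "injectively_labeled (reconstruct T)"
  by (simp add: injectively_labeled_def reconstruct_def inj_on_def)

lemma edge_reduced_reconstruct: "edge_reduced (inputs T) (reconstruct T)"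
proof -
  have "i = j \<or> (\<exists>u\<in>inputs T. j = succ_by_label (reconstruct T) i (select (reconstruct T) i u))"
    if edge: "(i, j) \<in> edges (reconstruct T)" for i j
  proof (cases "i = j")
    case False
    then obtain u where "i \<in> visible T" "u \<in> inputs T" "vis T (trans T (terminal T i) u) = j"
      using edge by (auto simp: reconstruct_def)
    then show ?thesis
      using succ_by_label_reconstruct by metis
  qed simp
  then have "{(i, j) \<in> edges (reconstruct T).
      i = j \<or> (\<exists>u\<in>inputs T. j = succ_by_label (reconstruct T) i (select (reconstruct T) i u))}
     = edges (reconstruct T)"
    by blast
  then show ?thesis
    by (simp add: edge_reduced_def prune_def)
qed

text \<open>The phase counts the holds still to come, hence the reversed index:
  \<open>(i, r)\<close> goes to the state from which \<open>r\<close> holds lead to the terminal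
  vertex. At positive phase, commutation is a step of the chain; at phase 0 it is exactly
  reset-on-decision.\<close>

lemma transducer_iso_at_entry:
  "transducer_iso (phase_expanded (inputs T) (reconstruct T)) (at_entry T)"
proof -
  let ?P = "phase_expanded (inputs T) (reconstruct T)"
  define f where "f = (\<lambda>(i, r). path i ! (length (path i) - 1 - r))"
  have ctrl: "ctrl ?P = {(i, r). i \<in> visible T \<and> r < length (path i)}"
    using path(1) by (auto simp: phase_expanded_def reconstruct_def card_fiber Suc_le_eq
        simp flip: less_Suc_eq_le)
  have f_in: "f (i, r) \<in> fiber T i" if "i \<in> visible T" "r < length (path i)" for i r
    using that path(3)[of i] by (auto simp: f_def simp flip: path(3))
  have f_top: "f (i, length (path i) - 1) = entry T i" and f_0: "f (i, 0) = terminal T i"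
    if "i \<in> visible T" for i
    using that path(1) by (simp_all add: f_def entry_eq terminal_eq hd_conv_nth last_conv_nth)
  have "inj_on f (ctrl ?P)"
  proof (rule inj_onI, clarify)
    fix i r i' r' assume *: "(i, r) \<in> ctrl ?P" "(i', r') \<in> ctrl ?P" "f (i, r) = f (i', r')"
    then have "i = i'"
      using f_in[of i r] f_in[of i' r'] by (auto simp: ctrl fiber_def)
    moreover from this have "length (path i) - 1 - r = length (path i) - 1 - r'"
      using * hold_chain_distinct[OF path(2), of i]
      by (auto simp: ctrl f_def nth_eq_iff_index_eq)
    ultimately show "i = i' \<and> r = r'"
      using * by (auto simp: ctrl)
  qed
  moreover have "f ` ctrl ?P = ctrl T"
  proof
    show "f ` ctrl ?P \<subseteq> ctrl T"
      using f_in fiber_ctrl by (auto simp: ctrl)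
    show "ctrl T \<subseteq> f ` ctrl ?P"
    proof
      fix q assume q: "q \<in> ctrl T"
      let ?i = "vis T q"
      have "q \<in> set (path ?i)"
        using q path(3)[OF vis_in[OF q]] by (simp add: fiber_def)
      then obtain k where "k < length (path ?i)" "q = path ?i ! k"
        by (auto simp: in_set_conv_nth)
      then show "q \<in> f ` ctrl ?P"
        using vis_in[OF q] by (intro image_eqI[of _ _ "(?i, length (path ?i) - 1 - k)"])
          (auto simp: ctrl f_def)
    qed
  qed
  ultimately have bij: "bij_betw f (ctrl ?P) (ctrl T)"
    by (simp add: bij_betw_def)
  have f_trans: "f (trans ?P (i, r) u) = trans T (f (i, r)) u"
    if i: "i \<in> visible T" and r: "r < length (path i)" and u: "u \<in> inputs T" for i r u
  proof (cases r)
    case 0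
    let ?j = "vis T (trans T (terminal T i) u)"
    have "f (trans ?P (i, r) u) = f (?j, length (path ?j) - 1)"
      using 0 succ_by_label_reconstruct[OF i u] card_fiber[OF vis_trans_terminal_in[OF i u]]
      by (simp add: phase_expanded_def) (simp add: reconstruct_def Let_def)
    then show ?thesis
      using 0 f_top vis_trans_terminal_in[OF i u] f_0[OF i] trans_terminal[OF i u] by simp
  next
    case (Suc r')
    let ?k = "length (path i) - 1 - r"
    have "holds_to T (path i ! ?k) (path i ! Suc ?k)"
      using path(2)[OF i] r Suc by (auto simp: hold_chain_def)
    moreover have "Suc ?k = length (path i) - 1 - r'"
      using Suc r by simp
    ultimately show ?thesis
      using u Suc by (simp add: holds_to_def f_def phase_expanded_def)
  qed
  have f_init: "f (init ?P) = init (at_entry T)"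
    using f_top[OF vis_in[OF init_in]] card_fiber[OF vis_in[OF init_in]]
    by (simp add: phase_expanded_def at_entry_def reconstruct_def)
  have P: "inputs ?P = inputs T" "visible ?P = visible T" "\<And>q. vis ?P q = fst q"
    by (simp_all add: phase_expanded_def reconstruct_def)
  have U: "inputs (at_entry T) = inputs T" "visible (at_entry T) = visible T"
      "ctrl (at_entry T) = ctrl T" "trans (at_entry T) = trans T" "vis (at_entry T) = vis T"
    by (simp_all add: at_entry_def)
  have "\<forall>q\<in>ctrl ?P. \<forall>u\<in>inputs T. f (trans ?P q u) = trans T (f q) u"
    using f_trans by (simp add: ctrl)
  moreover have "\<forall>q\<in>ctrl ?P. vis T (f q) = fst q"
    using fiber_vis[OF f_in] by (simp add: ctrl)
  ultimately show ?thesis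
    unfolding transducer_iso_def P U using bij f_init by blast
qed

text \<open>An isomorphism preserves visible labels, so it maps the phases of \<open>i\<close> onto
  the fiber of \<open>i\<close>; this fixes the dwell times, and locating phase 0 fixes the
  selections. Of the initial state only the visible label enters, which \<open>T\<close> and
  \<open>at_entry T\<close> share.\<close>

lemma underlying_system_unique:
  fixes A :: "('s, 'o, 'l) dlsl"
  assumes A: "symbolic_dlsl (inputs T) A" "injectively_labeled A"
    and U: "U = T \<or> U = at_entry T"
    and iso: "transducer_iso (phase_expanded (inputs T) A) U"
  shows "injective_relabeling (inputs T) (reconstruct T) (prune (inputs T) A)"
proof -
  let ?P = "phase_expanded (inputs T) A"
  have U_eq: "inputs U = inputs T" "visible U = visible T" "ctrl U = ctrl T"
      "trans U = trans T" "vis U = vis T" "vis T (init U) = vis T (init T)"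
    using U entry_in[OF vis_in[OF init_in]] by (auto simp: at_entry_def fiber_def)
  obtain f where bij: "bij_betw f (ctrl ?P) (ctrl T)" and f_init: "f (init ?P) = init U"
    and f_trans: "\<And>q u. q \<in> ctrl ?P \<Longrightarrow> u \<in> inputs T \<Longrightarrow> f (trans ?P q u) = trans T (f q) u"
    and f_vis: "\<And>q. q \<in> ctrl ?P \<Longrightarrow> vis T (f q) = vis ?P q"
    and states: "visible T = states A"
    using iso unfolding transducer_iso_def U_eq by (auto simp: phase_expanded_def)
  have dwell: "1 \<le> dwell A i" if "i \<in> visible T" for i
    using A that by (auto simp: symbolic_dlsl_def states)
  have ctrl: "ctrl ?P = {(i, r). i \<in> visible T \<and> r < dwell A i}"
    using dwell by (fastforce simp: phase_expanded_def states)
  have f_in: "f (i, r) \<in> fiber T i" if "i \<in> visible T" "r < dwell A i" for i r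
  proof -
    have "(i, r) \<in> ctrl ?P"
      using that by (simp add: ctrl)
    moreover have "vis ?P (i, r) = i"
      by (simp add: phase_expanded_def)
    ultimately show ?thesis
      using bij_betw_apply[OF bij] f_vis by (simp add: fiber_def)
  qed
  have fiber: "fiber T i = f ` ({i} \<times> {..<dwell A i})" if "i \<in> visible T" for i
  proof
    show "fiber T i \<subseteq> f ` ({i} \<times> {..<dwell A i})"
    proof
      fix q assume q: "q \<in> fiber T i"
      then have "q \<in> f ` ctrl ?P"
        using bij fiber_ctrl by (simp add: bij_betw_def)
      then obtain j r where "(j, r) \<in> ctrl ?P" "q = f (j, r)"
        by (auto)
      then show "q \<in> f ` ({i} \<times> {..<dwell A i})"
        using f_in[of j r] q by (auto simp: ctrl fiber_def)
    qed
  qed (use f_in that in auto)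
  have card: "card (fiber T i) = dwell A i" if "i \<in> visible T" for i
  proof -
    have "inj_on f ({i} \<times> {..<dwell A i})"
      using bij that by (auto simp: bij_betw_def ctrl intro: inj_on_subset)
    then show ?thesis
      by (simp add: fiber[OF that] card_image)
  qed
  have terminal: "terminal T i = f (i, 0)" if i: "i \<in> visible T" for i
  proof -
    obtain r where r: "r < dwell A i" "terminal T i = f (i, r)"
      using terminal_in[OF i] by (auto simp: fiber[OF i])
    \<comment> \<open>At a positive phase every input leads to one state of the same fiber, so its
      image is forced-hold, unlike the terminal vertex.\<close>
    have "r = 0"
    proof (rule ccontr)
      assume "r \<noteq> 0"
      then have "trans T (f (i, r)) u = f (i, r - 1)" if "u \<in> inputs T" for u
        using f_trans[of "(i, r)" u] that r i by (simp add: ctrl) (simp add: phase_expanded_def)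
      then have "holds_to T (f (i, r)) (f (i, r - 1))"
        using f_in[OF i, of r] f_in[OF i, of "r - 1"] r by (auto simp: holds_to_def fiber_def)
      then show False
        using terminal_decision[OF i] r by (auto simp: forced_hold_def)
    qed
    with r show ?thesis by simp
  qed
  have succ: "succ_by_label A i (select A i u) \<in> out_nbrs (states A) (edges A) i \<and>
      lbl A (succ_by_label A i (select A i u)) = select A i u"
    if "i \<in> visible T" "u \<in> inputs T" for i u
  proof -
    have "select A i u \<in> out_labels A i"
      using A that by (auto simp: symbolic_dlsl_def states)
    then obtain j where j: "j \<in> out_nbrs (states A) (edges A) i" "lbl A j = select A i u"
      by (auto simp: out_labels_def)
    have unique: "k = j" if "k \<in> out_nbrs (states A) (edges A) i" "lbl A k = select A i u" for k
      using that j A(2) by (auto simp: injectively_labeled_def out_nbrs_def inj_on_def)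
    have "succ_by_label A i (select A i u) = j"
      unfolding succ_by_label_def using j unique by (intro the_equality) blast+
    with j show ?thesis by simp
  qed
  have target: "vis T (trans T (terminal T i) u) = succ_by_label A i (select A i u)"
    if i: "i \<in> visible T" and u: "u \<in> inputs T" for i u
  proof -
    let ?j = "succ_by_label A i (select A i u)"
    have j: "?j \<in> visible T"
      using succ[OF i u] by (auto simp: out_nbrs_def states)
    have "trans T (f (i, 0)) u = f (?j, dwell A ?j - 1)"
      using f_trans[of "(i, 0)" u] i u dwell[OF i]
      by (simp add: ctrl Let_def Suc_le_eq) (simp add: phase_expanded_def Let_def)
    then show ?thesis
      using f_in[OF j, of "dwell A ?j - 1"] dwell[OF j]
      by (simp add: terminal[OF i] fiber_def)
  qed
  have start: "start A = vis T (init T)"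
  proof -
    have s: "start A \<in> visible T"
      using A by (simp add: symbolic_dlsl_def states)
    have "init U = f (start A, dwell A (start A) - 1)"
      using f_init by (simp add: phase_expanded_def)
    then have "init U \<in> fiber T (start A)"
      using f_in[OF s, of "dwell A (start A) - 1"] dwell[OF s] by simp
    then show ?thesis
      using U_eq by (simp add: fiber_def)
  qed
  have edges: "edges (prune (inputs T) A) = edges (reconstruct T)"
  proof -
    have "edges A \<subseteq> visible T \<times> visible T" "\<And>i. i \<in> visible T \<Longrightarrow> (i, i) \<in> edges A"
      using A by (auto simp: symbolic_dlsl_def self_looping_def states)
    moreover have "(i, succ_by_label A i (select A i u)) \<in> edges A"
      if "i \<in> visible T" "u \<in> inputs T" for i u
      using succ[OF that] by (simp add: out_nbrs_def)
    ultimately have "edges (prune (inputs T) A) = {(i, j). i \<in> visible T \<and> j \<in> visible T \<and>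
        (i = j \<or> (\<exists>u\<in>inputs T. j = succ_by_label A i (select A i u)))}"
      by (auto simp: prune_def)
    also have "\<dots> = {(i, j). i \<in> visible T \<and> j \<in> visible T \<and>
        (i = j \<or> (\<exists>u\<in>inputs T. j = vis T (trans T (terminal T i) u)))}"
      by (simp add: target cong: conj_cong bex_cong)
    also have "\<dots> = edges (reconstruct T)"
      by (auto simp: reconstruct_def)
    finally show ?thesis .
  qed
  \<comment> \<open>The reconstruction labels each visible state by itself, so \<open>lbl A\<close>
    is the relabeling.\<close>
  have "bij_betw (lbl A) (lbl (reconstruct T) ` states (reconstruct T))
      (lbl (prune (inputs T) A) ` states (prune (inputs T) A))"
    using A(2) by (simp add: bij_betw_def injectively_labeled_def prune_def reconstruct_def states)
  then show ?thesis
    unfolding injective_relabeling_def edges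
    using A(2) injectively_labeled_reconstruct start card succ target
    by (auto simp: prune_def reconstruct_def states injectively_labeled_def intro!: exI[of _ "lbl A"])
qed

end

section \<open>Weakest preconditions\<close>

text \<open>The elapsed time is passed along with the store, so that loop invariants can bound it.\<close>

definition wp :: "prog \<Rightarrow> (nat \<Rightarrow> store \<Rightarrow> bool) \<Rightarrow> nat \<Rightarrow> store \<Rightarrow> bool" where
  "wp P Q t s \<longleftrightarrow> (\<exists>t' s'. runs P s t' s' \<and> Q (t + t') s')"

text \<open>Determinism turns the existential in \<open>wp\<close> into evaluation at the unique
  final store, so that straight-line code can be executed by rewriting with equivalences.\<close>

lemma wp_runs: "runs P s n s' \<Longrightarrow> wp P Q t s \<longleftrightarrow> Q (t + n) s'"
  unfolding wp_def using runs_deterministic by blast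

lemma wp_basic [simp]:
  "wp Skip Q t s \<longleftrightarrow> Q (Suc t) s"
  "wp (Assign r x) Q t s \<longleftrightarrow> Q (Suc t) (set_reg r (val s x) s)"
  "wp (Succ r x) Q t s \<longleftrightarrow> Q (Suc t) (set_reg r (Suc (val s x)) s)"
  "wp (Load r a x) Q t s \<longleftrightarrow> Q (Suc t) (set_reg r (arrs s a (val s x)) s)"
  "wp (Store a x y) Q t s \<longleftrightarrow> Q (Suc t) (set_arr a (val s x) (val s y) s)"
  using wp_runs[OF runs.skip] wp_runs[OF runs.assign] wp_runs[OF runs.succ]
    wp_runs[OF runs.load] wp_runs[OF runs.store] by simp_all

lemma wp_Seq [simp]: "wp (Seq P P') Q t s \<longleftrightarrow> wp P (wp P' Q) t s"
proof
  assume "wp (Seq P P') Q t s"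
  then show "wp P (wp P' Q) t s"
    unfolding wp_def by (fastforce simp: add.assoc elim: runs_elims)
next
  assume "wp P (wp P' Q) t s"
  then show "wp (Seq P P') Q t s"
    unfolding wp_def by (metis add.assoc runs.seq)
qed

lemma wp_Cond [simp]:
  "wp (Cond b P P') Q t s \<longleftrightarrow> (if test_val s b then wp P Q (Suc t) s else wp P' Q (Suc t) s)"
proof (cases "test_val s b")
  case True
  then show ?thesis
    unfolding wp_def using runs.cond_true[OF True] by (fastforce elim: runs_elims)
next
  case False
  then show ?thesis
    unfolding wp_def using runs.cond_false[OF False] by (fastforce elim: runs_elims)
qed

text \<open>Every list is closed by a \<open>Skip\<close>, which costs one step and causes the
  trailing \<open>Seq _ Skip\<close> in later goals.\<close>

primrec seqs :: "prog list \<Rightarrow> prog" where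
  "seqs [] = Skip"
| "seqs (P # Ps) = Seq P (seqs Ps)"

text \<open>A total-correctness rule: \<open>m\<close> gives termination, while \<open>I\<close> may
  bound the elapsed time. \<open>Suc t\<close> charges the test, on entering the body as well as on
  leaving the loop.\<close>

lemma wp_While:
  assumes "I t s"
    and "\<And>t s. I t s \<Longrightarrow> test_val s b \<Longrightarrow> wp P (\<lambda>t' s'. I t' s' \<and> m s' < (m s :: nat)) (Suc t) s"
    and "\<And>t s. I t s \<Longrightarrow> \<not> test_val s b \<Longrightarrow> Q (Suc t) s"
  shows "wp (While b P) Q t s"
  using assms(1)
proof (induction "m s" arbitrary: t s rule: less_induct)
  case less
  show ?case
  proof (cases "test_val s b")
    case True
    then obtain t1 s1 where 1: "runs P s t1 s1" "I (Suc t + t1) s1" "m s1 < m s"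
      using assms(2)[OF less.prems] by (auto simp: wp_def)
    then obtain t2 s2 where "runs (While b P) s1 t2 s2" "Q (Suc t + t1 + t2) s2"
      using less.hyps[of s1 "Suc t + t1"] by (auto simp: wp_def)
    then show ?thesis
      using 1 runs.while_true[OF True 1(1)] unfolding wp_def
      by (metis add.assoc add_Suc_right add_Suc)
  next
    case False
    then show ?thesis
      using assms(3)[OF less.prems] runs.while_false unfolding wp_def by fastforce
  qed
qed

lemma store_simps [simp]:
  "regs (set_reg r v s) = (regs s)(r := v)"
  "arrs (set_reg r v s) = arrs s"
  "regs (set_arr a i v s) = regs s"
  "arrs (set_arr a i v s) = (arrs s)(a := (arrs s a)(i := v))"
  by (simp_all add: set_reg_def set_arr_def)

section \<open>The algorithm\<close>

text \<open>\<open>k\<close> is the position in the whole table and is not reset between rows: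
  without multiplication it can only be advanced.\<close>

definition scan_inputs :: prog where
  "scan_inputs = While (Less (Reg ''u'') (Reg ''nO'')) (seqs
     [Load ''y'' ''delta'' (Reg ''k''),
      Cond (Equal (Reg ''y'') (Reg ''first'')) Skip (Assign ''hold'' (Const 0)),
      Succ ''k'' (Reg ''k''),
      Succ ''u'' (Reg ''u'')])"

text \<open>Entries of \<open>prev\<close> and \<open>term\<close> may be overwritten, when a state
  has several predecessors or a fiber several decision states; the last one scanned
  survives.\<close>

definition scan_tail :: prog where
  "scan_tail = seqs
     [Cond (Equal (Reg ''hold'') (Const 1))
        (seqs [Succ ''y'' (Reg ''first''), Store ''prev'' (Reg ''y'') (Reg ''q1'')])
        (Store ''term'' (Reg ''i'') (Reg ''q1'')),
      Assign ''q'' (Reg ''q1'')]"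

text \<open>\<open>row\<close> saves where the row of each state begins, a product that
  \<open>emit_state\<close> could not recompute cheaply.\<close>

definition scan_row :: prog where
  "scan_row = seqs
     [Succ ''q1'' (Reg ''q''),
      Store ''row'' (Reg ''q1'') (Reg ''k''),
      Load ''first'' ''delta'' (Reg ''k''),
      Load ''i'' ''lambda'' (Reg ''q''),
      Load ''j'' ''lambda'' (Reg ''first''),
      Assign ''hold'' (Const 1),
      Cond (Equal (Reg ''i'') (Reg ''j'')) Skip (Assign ''hold'' (Const 0)),
      Assign ''u'' (Const 0),
      scan_inputs,
      scan_tail]"

definition scan :: prog where
  "scan = seqs
     [Assign ''q'' (Const 0),
      Assign ''k'' (Const 0),
      While (Less (Reg ''q'') (Reg ''nQ'')) scan_row]"

text \<open>\<open>ent\<close> is overwritten at every step, so that in the end it names the head of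
  the chain. \<open>cnt\<close> restarts with each fiber, \<open>total\<close> does not.\<close>

definition walk_chain :: prog where
  "walk_chain = While (Less (Const 0) (Reg ''cur'')) (seqs
     [Store ''ent'' (Reg ''i'') (Reg ''cur''),
      Succ ''cnt'' (Reg ''cnt''),
      Succ ''total'' (Reg ''total''),
      Load ''cur'' ''prev'' (Reg ''cur'')])"

definition walk_tail :: prog where
  "walk_tail = seqs
     [Store ''d'' (Reg ''i'') (Reg ''cnt''),
      Store ''label'' (Reg ''i'') (Reg ''i''),
      Succ ''i'' (Reg ''i'')]"

definition walk_fiber :: prog where
  "walk_fiber = seqs
     [Load ''cur'' ''term'' (Reg ''i''),
      Assign ''cnt'' (Const 0),
      walk_chain,
      walk_tail]"

definition walk :: prog where
  "walk = seqs
     [Assign ''i'' (Const 0),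
      Assign ''total'' (Const 0),
      While (Less (Reg ''i'') (Reg ''nS'')) walk_fiber]"

text \<open>Two positions are needed: \<open>r\<close> reads the row of the terminal vertex,
  \<open>k\<close> fills the row of the visible state in \<open>g\<close>. The target is incremented
  before the comparison because entries of \<open>ent\<close> are shifted by one.\<close>

definition emit_inputs :: prog where
  "emit_inputs = While (Less (Reg ''u'') (Reg ''nO'')) (seqs
     [Load ''y'' ''delta'' (Reg ''r''),
      Load ''j'' ''lambda'' (Reg ''y''),
      Store ''g'' (Reg ''k'') (Reg ''j''),
      Store ''src'' (Reg ''nE'') (Reg ''i''),
      Store ''dst'' (Reg ''nE'') (Reg ''j''),
      Succ ''nE'' (Reg ''nE''),
      Succ ''y'' (Reg ''y''),
      Load ''z'' ''ent'' (Reg ''j''),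
      Cond (Equal (Reg ''y'') (Reg ''z'')) Skip (Assign ''answer'' (Const 0)),
      Succ ''r'' (Reg ''r''),
      Succ ''k'' (Reg ''k''),
      Succ ''u'' (Reg ''u'')])"

definition emit_state :: prog where
  "emit_state = seqs
     [Load ''p'' ''term'' (Reg ''i''),
      Load ''r'' ''row'' (Reg ''p''),
      Store ''src'' (Reg ''nE'') (Reg ''i''),
      Store ''dst'' (Reg ''nE'') (Reg ''i''),
      Succ ''nE'' (Reg ''nE''),
      Assign ''u'' (Const 0),
      emit_inputs,
      Succ ''i'' (Reg ''i'')]"

definition emit :: prog where
  "emit = seqs
     [Load ''s0'' ''lambda'' (Reg ''q0''),
      Assign ''answer'' (Const 1),
      Assign ''i'' (Const 0),
      Assign ''k'' (Const 0),
      Assign ''nE'' (Const 0),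
      While (Less (Reg ''i'') (Reg ''nS'')) emit_state]"

text \<open>The guard protects \<open>emit\<close>: if some fiber is not a path, its entry in
  \<open>term\<close> may be 0 or an arbitrary candidate.\<close>

definition decide :: prog where
  "decide = seqs
     [scan, walk,
      Cond (Equal (Reg ''total'') (Reg ''nQ'')) emit (Assign ''answer'' (Const 0))]"

section \<open>Correctness and running time\<close>

text \<open>The edge set of \<open>output_system\<close> as a function of the list length, so that
  an append becomes an \<open>insert\<close>.\<close>

definition edge_list :: "(nat \<Rightarrow> nat) \<Rightarrow> (nat \<Rightarrow> nat) \<Rightarrow> nat \<Rightarrow> (nat \<times> nat) set" where
  "edge_list S D n = (\<lambda>e. (S e, D e)) ` {..<n}"

lemma edge_list_0 [simp]: "edge_list S D 0 = {}"
  by (simp add: edge_list_def)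

lemma edge_list_Suc [simp]:
  "edge_list (S(n := a)) (D(n := b)) (Suc n) = insert (a, b) (edge_list S D n)"
  by (auto simp: edge_list_def lessThan_Suc)

section \<open>Numbered transducers and the row test for forced holds\<close>

locale numbered_transducer = visible_graph_transducer V T
  for V :: "(nat \<times> nat) set" and T :: "(nat, nat, nat) transducer" +
  assumes numbered: "numbered T"
begin

abbreviation "nQ \<equiv> card (ctrl T)"
abbreviation "nO \<equiv> card (inputs T)"
abbreviation "nS \<equiv> card (visible T)"

lemma ctrl_eq: "ctrl T = {..<nQ}" and inputs_eq: "inputs T = {..<nO}"
  and visible_eq: "visible T = {..<nS}"
  using numbered by (simp_all add: numbered_def)

lemma in_ctrl [simp]: "q \<in> ctrl T \<longleftrightarrow> q < nQ" and in_inputs [simp]: "u \<in> inputs T \<longleftrightarrow> u < nO"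
  and in_visible [simp]: "i \<in> visible T \<longleftrightarrow> i < nS"
  using ctrl_eq inputs_eq visible_eq by blast+

lemma nO_pos: "0 < nO"
  using inputs_nonempty inputs_eq by (metis gr0I lessThan_0)

lemma row_major_less:
  assumes "i < n" "u < nO"
  shows "i * nO + u < n * nO"
proof -
  have "i * nO + u < Suc i * nO"
    using assms(2) by simp
  also have "\<dots> \<le> n * nO"
    using assms(1) by (intro mult_le_mono1) simp
  finally show ?thesis .
qed

lemma nQ_pos: "0 < nQ"
  using init_in by simp

lemma nS_le: "nS \<le> nQ"
  using vis_image finite_ctrl card_image_le by metis

lemma trans_less: "q < nQ \<Longrightarrow> u < nO \<Longrightarrow> trans T q u < nQ"
  using trans_in by simp

lemma vis_less: "q < nQ \<Longrightarrow> vis T q < nS"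
  using vis_in by simp

definition constant_below :: "nat \<Rightarrow> nat \<Rightarrow> bool" where
  "constant_below q n \<longleftrightarrow> (\<forall>u<n. trans T q u = trans T q 0)"

lemma constant_below_0 [simp]: "constant_below q 0"
  by (simp add: constant_below_def)

lemma constant_below_Suc [simp]:
  "constant_below q (Suc n) \<longleftrightarrow> constant_below q n \<and> trans T q n = trans T q 0"
  unfolding constant_below_def less_Suc_eq by blast

lemma holds_to_first:
  assumes "q < nQ"
  shows "holds_to T q (trans T q 0) \<longleftrightarrow> vis T (trans T q 0) = vis T q \<and> constant_below q nO"
  by (simp only: holds_to_def constant_below_def in_ctrl Ball_def in_inputs
      trans_less[OF assms nO_pos] simp_thms)

text \<open>Input 0 exists, so its successor is the only possible target of a hold, and one scan of
  the row settles the existential quantifier.\<close>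

lemma forced_hold_first: "forced_hold T q \<longleftrightarrow> holds_to T q (trans T q 0)"
proof
  assume "forced_hold T q"
  then obtain q' where "holds_to T q q'"
    by (auto simp: forced_hold_def)
  moreover from this have "trans T q 0 = q'"
    using nO_pos by (simp add: holds_to_def)
  ultimately show "holds_to T q (trans T q 0)"
    by simp
qed (auto simp: forced_hold_def)

section \<open>Invariants of the tables\<close>

definition input_in :: "store \<Rightarrow> bool" where
  "input_in s \<longleftrightarrow> regs s ''nQ'' = nQ \<and> regs s ''nO'' = nO \<and> regs s ''nS'' = nS \<and>
     regs s ''q0'' = init T \<and>
     (\<forall>q<nQ. \<forall>u<nO. arrs s ''delta'' (q * nO + u) = trans T q u) \<and>
     (\<forall>q<nQ. arrs s ''lambda'' q = vis T q)"

definition rows :: "nat \<Rightarrow> (nat \<Rightarrow> nat) \<Rightarrow> bool" where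
  "rows n R \<longleftrightarrow> (\<forall>q<n. R (Suc q) = q * nO)"

text \<open>Array entries that refer to control states are shifted by one; 0 stands for no state.\<close>

definition terms :: "nat \<Rightarrow> (nat \<Rightarrow> nat) \<Rightarrow> bool" where
  "terms n A \<longleftrightarrow> (\<forall>i. (A i = 0 \<and> (\<forall>q<n. vis T q = i \<longrightarrow> forced_hold T q)) \<or>
     (\<exists>q<n. A i = Suc q \<and> vis T q = i \<and> \<not> forced_hold T q))"

text \<open>Some predecessor among the states scanned so far is promised, not a particular one; what
  later matters is that 0 excludes them all.\<close>

definition prevs :: "nat \<Rightarrow> (nat \<Rightarrow> nat) \<Rightarrow> bool" where
  "prevs n A \<longleftrightarrow> (\<forall>x. (A x = 0 \<and> (\<forall>q<n. \<forall>q'. holds_to T q q' \<longrightarrow> x \<noteq> Suc q')) \<or>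
     (\<exists>q<n. \<exists>q'. A x = Suc q \<and> holds_to T q q' \<and> x = Suc q'))"

lemma terms_0 [simp]: "terms 0 (\<lambda>_. 0)" and prevs_0 [simp]: "prevs 0 (\<lambda>_. 0)"
  and rows_0 [simp]: "rows 0 R"
  by (simp_all add: terms_def prevs_def rows_def)

lemma rows_Suc: "rows n R \<Longrightarrow> rows (Suc n) (R(Suc n := n * nO))"
  by (simp add: rows_def less_Suc_eq)

lemma terms_hold:
  assumes "terms n A" "forced_hold T n"
  shows "terms (Suc n) A"
  unfolding terms_def
proof
  fix i
  from assms(1)[unfolded terms_def, rule_format, of i]
  show "(A i = 0 \<and> (\<forall>q<Suc n. vis T q = i \<longrightarrow> forced_hold T q)) \<or>
     (\<exists>q<Suc n. A i = Suc q \<and> vis T q = i \<and> \<not> forced_hold T q)"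
    using assms(2) by (elim disjE) (auto simp: less_Suc_eq)
qed

lemma terms_decision:
  assumes "terms n A" "\<not> forced_hold T n"
  shows "terms (Suc n) (A(vis T n := Suc n))"
  unfolding terms_def
proof
  fix i
  let ?A = "A(vis T n := Suc n)"
  from assms(1)[unfolded terms_def, rule_format, of i]
  show "(?A i = 0 \<and> (\<forall>q<Suc n. vis T q = i \<longrightarrow> forced_hold T q)) \<or>
     (\<exists>q<Suc n. ?A i = Suc q \<and> vis T q = i \<and> \<not> forced_hold T q)"
    using assms(2) by (cases "i = vis T n"; elim disjE) (auto simp: less_Suc_eq)
qed

text \<open>An earlier predecessor of \<open>q'\<close> may be lost here, which the invariant
  tolerates.\<close>

lemma prevs_hold:
  assumes "prevs n A" "holds_to T n q'"
  shows "prevs (Suc n) (A(Suc q' := Suc n))"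
  unfolding prevs_def
proof
  fix x
  let ?A = "A(Suc q' := Suc n)"
  have n: "holds_to T n r \<longleftrightarrow> r = q'" for r
    using assms(2) holds_to_unique by blast
  from assms(1)[unfolded prevs_def, rule_format, of x]
  show "(?A x = 0 \<and> (\<forall>q<Suc n. \<forall>q'. holds_to T q q' \<longrightarrow> x \<noteq> Suc q')) \<or>
     (\<exists>q<Suc n. \<exists>q'. ?A x = Suc q \<and> holds_to T q q' \<and> x = Suc q')"
    by (cases "x = Suc q'"; elim disjE) (auto simp: less_Suc_eq n)
qed

lemma prevs_decision:
  assumes "prevs n A" "\<not> forced_hold T n"
  shows "prevs (Suc n) A"
  unfolding prevs_def
proof
  fix x
  from assms(1)[unfolded prevs_def, rule_format, of x]
  show "(A x = 0 \<and> (\<forall>q<Suc n. \<forall>q'. holds_to T q q' \<longrightarrow> x \<noteq> Suc q')) \<or>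
     (\<exists>q<Suc n. \<exists>q'. A x = Suc q \<and> holds_to T q q' \<and> x = Suc q')"
    using assms(2) by (elim disjE) (auto simp: less_Suc_eq forced_hold_def)
qed

definition scanned :: "nat \<Rightarrow> store \<Rightarrow> bool" where
  "scanned n s \<longleftrightarrow> input_in s \<and> n \<le> nQ \<and> rows n (arrs s ''row'') \<and> terms n (arrs s ''term'') \<and>
     prevs n (arrs s ''prev'')"

text \<open>Lets simplification discard updates of scratch registers and of other arrays; the side
  conditions only compare string literals.\<close>

lemma input_in_frame [simp]:
  "r \<notin> {''nQ'', ''nO'', ''nS'', ''q0''} \<Longrightarrow> input_in (set_reg r v s) \<longleftrightarrow> input_in s"
  "a \<notin> {''delta'', ''lambda''} \<Longrightarrow> input_in (set_arr a i v s) \<longleftrightarrow> input_in s"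
  by (auto simp: input_in_def)

lemma scanned_frame [simp]:
  "r \<notin> {''nQ'', ''nO'', ''nS'', ''q0''} \<Longrightarrow> scanned n (set_reg r v s) \<longleftrightarrow> scanned n s"
  "a \<notin> {''delta'', ''lambda'', ''row'', ''term'', ''prev''} \<Longrightarrow>
     scanned n (set_arr a i v s) \<longleftrightarrow> scanned n s"
  by (auto simp: scanned_def)

lemma input_in_regs:
  "input_in s \<Longrightarrow> regs s ''nQ'' = nQ" "input_in s \<Longrightarrow> regs s ''nO'' = nO"
  "input_in s \<Longrightarrow> regs s ''nS'' = nS" "input_in s \<Longrightarrow> regs s ''q0'' = init T"
  by (auto simp: input_in_def)

text \<open>The second fact is the case \<open>u = 0\<close> in the form that simplification
  leaves.\<close>

lemma input_in_arrs:
  "input_in s \<Longrightarrow> q < nQ \<Longrightarrow> u < nO \<Longrightarrow> arrs s ''delta'' (q * nO + u) = trans T q u"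
  "input_in s \<Longrightarrow> q < nQ \<Longrightarrow> 0 < nO \<Longrightarrow> arrs s ''delta'' (q * nO) = trans T q 0"
  "input_in s \<Longrightarrow> q < nQ \<Longrightarrow> arrs s ''lambda'' q = vis T q"
  unfolding input_in_def by (blast, metis add.right_neutral, blast)

lemma scanned_input: "scanned n s \<Longrightarrow> input_in s"
  by (simp add: scanned_def)

lemmas input_facts = input_in_regs input_in_arrs input_in_regs[OF scanned_input]
  input_in_arrs[OF scanned_input]

section \<open>The scan of the transition table\<close>

definition scanning :: "nat \<Rightarrow> nat \<Rightarrow> store \<Rightarrow> bool" where
  "scanning q t s \<longleftrightarrow> input_in s \<and> q < nQ \<and> rows (Suc q) (arrs s ''row'') \<and>
     terms q (arrs s ''term'') \<and> prevs q (arrs s ''prev'') \<and>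
     regs s ''q'' = q \<and> regs s ''q1'' = Suc q \<and> regs s ''first'' = trans T q 0 \<and>
     regs s ''i'' = vis T q \<and> regs s ''u'' \<le> nO \<and> regs s ''k'' = q * nO + regs s ''u'' \<and>
     regs s ''hold'' = of_bool (vis T (trans T q 0) = vis T q \<and> constant_below q (regs s ''u'')) \<and>
     t \<le> 10 * regs s ''k'' + 30 * q + 20"

lemma wp_scan_inputs:
  assumes "scanning q t s"
    and "\<And>t s. scanning q t s \<Longrightarrow> regs s ''u'' = nO \<Longrightarrow> Q (Suc t) s"
  shows "wp scan_inputs Q t s"
  unfolding scan_inputs_def
proof (rule wp_While[where I = "scanning q" and m = "\<lambda>s. nO - regs s ''u''"])
  fix t s assume "scanning q t s" "test_val s (Less (Reg ''u'') (Reg ''nO''))"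
  then show "wp (seqs
     [Load ''y'' ''delta'' (Reg ''k''),
      Cond (Equal (Reg ''y'') (Reg ''first'')) Skip (Assign ''hold'' (Const 0)),
      Succ ''k'' (Reg ''k''),
      Succ ''u'' (Reg ''u'')])
     (\<lambda>t' s'. scanning q t' s' \<and> nO - regs s' ''u'' < nO - regs s ''u'') (Suc t) s"
    by (auto simp: scanning_def input_facts less_Suc_eq)
next
  fix t s assume "scanning q t s" "\<not> test_val s (Less (Reg ''u'') (Reg ''nO''))"
  then show "Q (Suc t) s"
    by (intro assms(2)) (auto simp: scanning_def input_facts)
qed fact

text \<open>Time is charged to the counters that advance: 10 steps for each table entry passed by
  \<open>k\<close>, 30 for each row, both with slack.\<close>

definition scan_inv :: "nat \<Rightarrow> store \<Rightarrow> bool" where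
  "scan_inv t s \<longleftrightarrow> scanned (regs s ''q'') s \<and> regs s ''k'' = regs s ''q'' * nO \<and>
     t \<le> 10 * regs s ''k'' + 30 * regs s ''q'' + 5"

lemma wp_scan_tail:
  assumes "scanning q t s" "regs s ''u'' = nO"
    and Q: "\<And>t s. scan_inv t s \<Longrightarrow> regs s ''q'' = Suc q \<Longrightarrow> Q t s"
  shows "wp (Seq scan_tail Skip) Q (Suc t) s"
proof (cases "forced_hold T q")
  case True
  then have "holds_to T q (trans T q 0)"
    by (simp add: forced_hold_first)
  moreover from this have "regs s ''hold'' = 1"
    using assms by (simp add: scanning_def holds_to_first)
  ultimately show ?thesis
    using assms(1,2) True unfolding scan_tail_def
    by (auto simp: scanning_def scan_inv_def scanned_def terms_hold prevs_hold intro!: Q)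
next
  case False
  then have "regs s ''hold'' = 0"
    using assms(1,2) by (simp add: scanning_def holds_to_first forced_hold_first)
  then show ?thesis
    using assms(1,2) False unfolding scan_tail_def
    by (auto simp: scanning_def scan_inv_def scanned_def terms_decision prevs_decision intro!: Q)
qed

lemma wp_scan_row:
  assumes I: "scan_inv t s" and q: "regs s ''q'' < nQ"
    and Q: "\<And>t' s'. scan_inv t' s' \<Longrightarrow> regs s' ''q'' = Suc (regs s ''q'') \<Longrightarrow> Q t' s'"
  shows "wp scan_row Q (Suc t) s"
proof -
  let ?q = "regs s ''q''"
  have first: "arrs s ''delta'' (?q * nO) = trans T ?q 0"
    "arrs s ''lambda'' ?q = vis T ?q" "arrs s ''lambda'' (trans T ?q 0) = vis T (trans T ?q 0)"
    using I q nO_pos trans_less by (auto simp: scan_inv_def input_facts)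
  \<comment> \<open>The rest of the row program is the postcondition of the inner loop; in this form
    the fact is an introduction rule for the goal left by symbolic execution.\<close>
  have inputs: "wp scan_inputs (wp (Seq scan_tail Skip) Q) t' s'" if "scanning ?q t' s'" for t' s'
    using that
  proof (rule wp_scan_inputs)
    fix t s assume "scanning ?q t s" "regs s ''u'' = nO"
    then show "wp (Seq scan_tail Skip) Q (Suc t) s"
      by (rule wp_scan_tail) (rule Q)
  qed
  show ?thesis
    using I q rows_Suc[of ?q] unfolding scan_row_def
    by (auto simp: first scan_inv_def scanned_def scanning_def intro!: inputs)
qed

lemma wp_scan:
  assumes "scanned 0 s"
    and Q: "\<And>t s. scanned nQ s \<Longrightarrow> t \<le> 10 * (nQ * nO) + 30 * nQ + 10 \<Longrightarrow> Q t s"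
  shows "wp scan Q 0 s"
proof -
  have loop: "wp (While (Less (Reg ''q'') (Reg ''nQ'')) scan_row) Q' t' s'"
    if "scan_inv t' s'"
      "\<And>t s. scan_inv t s \<Longrightarrow> regs s ''q'' = nQ \<Longrightarrow> Q' (Suc t) s" for t' s' Q'
  proof (rule wp_While[where I = scan_inv and m = "\<lambda>s. nQ - regs s ''q''"])
    fix t s assume I: "scan_inv t s" and "test_val s (Less (Reg ''q'') (Reg ''nQ''))"
    then have q: "regs s ''q'' < nQ"
      by (auto simp: scan_inv_def input_facts)
    show "wp scan_row (\<lambda>t' s'. scan_inv t' s' \<and> nQ - regs s' ''q'' < nQ - regs s ''q'') (Suc t) s"
      using q by (intro wp_scan_row[OF I q]) auto
  next
    fix t s assume "scan_inv t s" "\<not> test_val s (Less (Reg ''q'') (Reg ''nQ''))"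
    then show "Q' (Suc t) s"
      by (intro that(2)) (auto simp: scan_inv_def input_facts scanned_def)
  qed fact
  show ?thesis
    unfolding scan_def
    by (auto simp: scan_inv_def assms(1) intro!: loop Q)
qed

section \<open>The backward walks\<close>

definition walked :: "nat \<Rightarrow> store \<Rightarrow> bool" where
  "walked n s \<longleftrightarrow> scanned nQ s \<and> n \<le> nS \<and>
     (\<forall>j<n. arrs s ''label'' j = j \<and> (\<exists>vs. maximal_chain j vs \<and> arrs s ''d'' j = length vs \<and>
        (vs \<noteq> [] \<longrightarrow> arrs s ''ent'' j = Suc (hd vs))))"

lemma walked_frame [simp]:
  "r \<notin> {''nQ'', ''nO'', ''nS'', ''q0''} \<Longrightarrow> walked n (set_reg r v s) \<longleftrightarrow> walked n s"
  "a \<in> {''ent'', ''d'', ''label''} \<Longrightarrow> n \<le> j \<Longrightarrow> walked n (set_arr a j v s) \<longleftrightarrow> walked n s"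
  by (auto simp: walked_def)

text \<open>The right-hand side of \<open>cur\<close> is what the register \<open>cur\<close> holds
  in either situation: \<open>term\<close> starts a chain, \<open>prev\<close> continues it. A
  nonzero value therefore names a state that can be put in front.\<close>

lemma chain_extend:
  assumes s: "scanned nQ s" and vs: "hold_chain i vs"
    and cur: "Suc q = (if vs = [] then arrs s ''term'' i else arrs s ''prev'' (Suc (hd vs)))"
  shows "hold_chain i (q # vs)"
proof (cases "vs = []")
  case True
  then have "q < nQ \<and> vis T q = i \<and> \<not> forced_hold T q"
    using s cur unfolding scanned_def terms_def by (metis Suc_inject nat.distinct(1))
  with True show ?thesis
    by (simp add: hold_chain_singleton fiber_def)
next
  case False
  then have "q < nQ \<and> holds_to T q (hd vs)"
    using s cur unfolding scanned_def prevs_def by (metis Suc_inject nat.distinct(1))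
  with False vs show ?thesis
    by (simp add: hold_chain_Cons)
qed

text \<open>The tables cover all \<open>nQ\<close> states, so the value 0 certifies exhaustion: the
  fiber has no decision state, or the head has no predecessor.\<close>

lemma chain_maximal:
  assumes s: "scanned nQ s" and vs: "hold_chain i vs"
    and cur: "0 = (if vs = [] then arrs s ''term'' i else arrs s ''prev'' (Suc (hd vs)))"
  shows "maximal_chain i vs"
proof (cases "vs = []")
  case True
  then have "\<forall>q<nQ. vis T q = i \<longrightarrow> forced_hold T q"
    using s cur unfolding scanned_def terms_def by (metis nat.distinct(1))
  with True vs show ?thesis
    by (simp add: maximal_chain_def fiber_def)
next
  case False
  then have "\<forall>q<nQ. \<forall>q'. holds_to T q q' \<longrightarrow> Suc (hd vs) \<noteq> Suc q'"
    using s cur unfolding scanned_def prevs_def by (metis nat.distinct(1))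
  with False vs show ?thesis
    by (auto simp: maximal_chain_def)
qed

text \<open>Chain steps are charged to \<open>total\<close>. As it never exceeds \<open>nQ\<close>,
  all walks together stay linear, although a single one may be as long as its fiber. The first
  summands are the budget of the scan.\<close>

definition walk_inv :: "nat \<Rightarrow> store \<Rightarrow> bool" where
  "walk_inv t s \<longleftrightarrow> walked (regs s ''i'') s \<and> regs s ''total'' = (\<Sum>j<regs s ''i''. arrs s ''d'' j) \<and>
     t \<le> 10 * (nQ * nO) + 30 * nQ + 15 + 10 * regs s ''total'' + 20 * regs s ''i''"

definition walking :: "nat \<Rightarrow> nat \<Rightarrow> store \<Rightarrow> bool" where
  "walking i t s \<longleftrightarrow> walked i s \<and> i < nS \<and> regs s ''i'' = i \<and>
     regs s ''total'' = (\<Sum>j<i. arrs s ''d'' j) + regs s ''cnt'' \<and>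
     (\<exists>vs. hold_chain i vs \<and> regs s ''cnt'' = length vs \<and>
        (vs \<noteq> [] \<longrightarrow> arrs s ''ent'' i = Suc (hd vs)) \<and>
        regs s ''cur'' = (if vs = [] then arrs s ''term'' i else arrs s ''prev'' (Suc (hd vs)))) \<and>
     t \<le> 10 * (nQ * nO) + 30 * nQ + 20 + 10 * regs s ''total'' + 20 * i"

lemma wp_walk_chain:
  assumes "walking i t s"
    and Q: "\<And>t s. walking i t s \<Longrightarrow> regs s ''cur'' = 0 \<Longrightarrow> Q (Suc t) s"
  shows "wp walk_chain Q t s"
  unfolding walk_chain_def
proof (rule wp_While[where I = "walking i" and m = "\<lambda>s. card (fiber T i) - regs s ''cnt''"])
  fix t s assume w: "walking i t s" and "test_val s (Less (Const 0) (Reg ''cur''))"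
  then obtain q where q: "regs s ''cur'' = Suc q"
    using gr0_implies_Suc by auto
  obtain vs where vs: "hold_chain i vs" "regs s ''cnt'' = length vs"
      "Suc q = (if vs = [] then arrs s ''term'' i else arrs s ''prev'' (Suc (hd vs)))"
    using w q by (auto simp: walking_def)
  have chain: "hold_chain i (q # vs)"
    using w vs by (intro chain_extend[of s]) (auto simp: walking_def walked_def)
  \<comment> \<open>The extended chain still fits into the fiber, so the measure strictly
    decreases.\<close>
  have "length vs < card (fiber T i)"
    using hold_chain_length_le[OF chain] by simp
  then show "wp (seqs
     [Store ''ent'' (Reg ''i'') (Reg ''cur''),
      Succ ''cnt'' (Reg ''cnt''),
      Succ ''total'' (Reg ''total''),
      Load ''cur'' ''prev'' (Reg ''cur'')])
     (\<lambda>t' s'. walking i t' s' \<and> card (fiber T i) - regs s' ''cnt'' < card (fiber T i) - regs s ''cnt'')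
     (Suc t) s"
    using w q vs(2) chain by (auto simp: walking_def intro!: exI[of _ "q # vs"])
next
  fix t s assume "walking i t s" "\<not> test_val s (Less (Const 0) (Reg ''cur''))"
  then show "Q (Suc t) s"
    by (intro Q) auto
qed fact

lemma wp_walk_tail:
  assumes w: "walking i t s" and "regs s ''cur'' = 0"
    and Q: "\<And>t s. walk_inv t s \<Longrightarrow> regs s ''i'' = Suc i \<Longrightarrow> Q t s"
  shows "wp (Seq walk_tail Skip) Q (Suc t) s"
proof -
  obtain vs where vs: "hold_chain i vs" "regs s ''cnt'' = length vs"
      "vs \<noteq> [] \<longrightarrow> arrs s ''ent'' i = Suc (hd vs)"
      "0 = (if vs = [] then arrs s ''term'' i else arrs s ''prev'' (Suc (hd vs)))"
    using assms(1,2) by (auto simp: walking_def)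
  then have max: "maximal_chain i vs"
    using w by (intro chain_maximal[of s]) (auto simp: walking_def walked_def)
  let ?s = "set_reg ''i'' (Suc i) (set_arr ''label'' i i (set_arr ''d'' i (length vs) s))"
  have "walked (Suc i) ?s"
    using w max vs(2,3) unfolding walked_def walking_def
    by (auto simp: less_Suc_eq Suc_le_eq intro!: exI[of _ vs])
  \<comment> \<open>The six steps are the exit test of the loop, three instructions and two closing
    \<open>Skip\<close>s.\<close>
  then have "walk_inv (Suc (Suc (Suc (Suc (Suc (Suc t)))))) ?s"
    using w vs(2) by (auto simp: walk_inv_def walking_def)
  then show ?thesis
    using w vs(2) Q unfolding walk_tail_def by (auto simp: walking_def)
qed

lemma wp_walk_fiber:
  assumes I: "walk_inv t s" and i: "regs s ''i'' < nS"
    and Q: "\<And>t' s'. walk_inv t' s' \<Longrightarrow> regs s' ''i'' = Suc (regs s ''i'') \<Longrightarrow> Q t' s'"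
  shows "wp walk_fiber Q (Suc t) s"
proof -
  let ?i = "regs s ''i''"
  have chain: "wp walk_chain (wp (Seq walk_tail Skip) Q) t' s'" if "walking ?i t' s'" for t' s'
    using that
  proof (rule wp_walk_chain)
    fix t s assume "walking ?i t s" "regs s ''cur'' = 0"
    then show "wp (Seq walk_tail Skip) Q (Suc t) s"
      by (rule wp_walk_tail) (rule Q)
  qed
  show ?thesis
    using I i unfolding walk_fiber_def
    by (auto simp: walk_inv_def walking_def hold_chain_Nil intro!: chain exI[of _ "[]"])
qed

lemma wp_walk:
  assumes "scanned nQ s" "t \<le> 10 * (nQ * nO) + 30 * nQ + 10"
    and Q: "\<And>t s. walk_inv t s \<Longrightarrow> regs s ''i'' = nS \<Longrightarrow> Q (Suc (Suc t)) s"
  shows "wp walk Q t s"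
proof -
  have loop: "wp (While (Less (Reg ''i'') (Reg ''nS'')) walk_fiber) Q' t' s'"
    if "walk_inv t' s'"
      "\<And>t s. walk_inv t s \<Longrightarrow> regs s ''i'' = nS \<Longrightarrow> Q' (Suc t) s" for t' s' Q'
  proof (rule wp_While[where I = walk_inv and m = "\<lambda>s. nS - regs s ''i''"])
    fix t s assume I: "walk_inv t s" and "test_val s (Less (Reg ''i'') (Reg ''nS''))"
    then have i: "regs s ''i'' < nS"
      by (auto simp: walk_inv_def walked_def input_facts)
    show "wp walk_fiber (\<lambda>t' s'. walk_inv t' s' \<and> nS - regs s' ''i'' < nS - regs s ''i'') (Suc t) s"
      using i by (intro wp_walk_fiber[OF I i]) auto
  next
    fix t s assume "walk_inv t s" "\<not> test_val s (Less (Reg ''i'') (Reg ''nS''))"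
    then show "Q' (Suc t) s"
      by (intro that(2)) (auto simp: walk_inv_def walked_def input_facts)
  qed fact
  have "walked 0 s"
    using assms(1) by (simp add: walked_def)
  then show ?thesis
    using assms(2) unfolding walk_def
    by (auto simp: walk_inv_def intro!: loop Q)
qed

section \<open>Chain lengths against fiber sizes\<close>

lemma walked_lengths:
  assumes "walked n s" "j < n"
  shows "arrs s ''d'' j \<le> card (fiber T j)"
    and "simple_path_graph (fiber T j) (hold_graph T j) \<longleftrightarrow> arrs s ''d'' j = card (fiber T j)"
proof -
  obtain vs where vs: "maximal_chain j vs" "arrs s ''d'' j = length vs" and j: "j < nS"
    using assms by (auto simp: walked_def)
  then show "arrs s ''d'' j \<le> card (fiber T j)"
    by (simp add: hold_chain_length_le maximal_chain_def)
  show "simple_path_graph (fiber T j) (hold_graph T j) \<longleftrightarrow> arrs s ''d'' j = card (fiber T j)"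
    using maximal_chain_path_iff(1)[OF _ vs(1)] vs(2) j by simp
qed

lemma sum_card_fiber_less: "(\<Sum>j<nS. card (fiber T j)) = nQ"
  using sum_card_fiber by (simp flip: visible_eq)

lemma walked_total_le: "walked nS s \<Longrightarrow> (\<Sum>j<nS. arrs s ''d'' j) \<le> nQ"
  unfolding sum_card_fiber_less[symmetric] by (intro sum_mono walked_lengths) auto

text \<open>Each chain length is bounded by its own fiber, so no fiber can make up for the deficit
  of another: equal sums force equality term by term.\<close>

lemma walked_total_eq_iff:
  assumes "walked nS s"
  shows "(\<Sum>j<nS. arrs s ''d'' j) = nQ \<longleftrightarrow>
    (\<forall>j<nS. simple_path_graph (fiber T j) (hold_graph T j))"
proof
  assume "(\<Sum>j<nS. arrs s ''d'' j) = nQ"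
  then have "(\<Sum>j<nS. arrs s ''d'' j) = (\<Sum>j<nS. card (fiber T j))"
    by (simp only: sum_card_fiber_less)
  then have "arrs s ''d'' j = card (fiber T j)" if "j < nS" for j
    using that by (intro sum_mono_inv[of "arrs s ''d''" "{..<nS}" "\<lambda>j. card (fiber T j)"])
      (auto intro: walked_lengths[OF assms])
  then show "\<forall>j<nS. simple_path_graph (fiber T j) (hold_graph T j)"
    using walked_lengths(2)[OF assms] by simp
next
  assume "\<forall>j<nS. simple_path_graph (fiber T j) (hold_graph T j)"
  then have "(\<Sum>j<nS. arrs s ''d'' j) = (\<Sum>j<nS. card (fiber T j))"
    using walked_lengths(2)[OF assms] by (intro sum.cong) auto
  then show "(\<Sum>j<nS. arrs s ''d'' j) = nQ"
    by (simp only: sum_card_fiber_less)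
qed

section \<open>Emission of the system and the reset test\<close>

definition ready :: "store \<Rightarrow> bool" where
  "ready s \<longleftrightarrow> scanned nQ s \<and>
     (\<forall>j<nS. terminal T j < nQ \<and> arrs s ''term'' j = Suc (terminal T j) \<and>
        arrs s ''ent'' j = Suc (entry T j) \<and> arrs s ''d'' j = card (fiber T j) \<and>
        arrs s ''label'' j = j)"

lemma ready_frame [simp]:
  "r \<notin> {''nQ'', ''nO'', ''nS'', ''q0''} \<Longrightarrow> ready (set_reg r v s) \<longleftrightarrow> ready s"
  "a \<notin> {''delta'', ''lambda'', ''row'', ''term'', ''prev'', ''ent'', ''d'', ''label''} \<Longrightarrow>
     ready (set_arr a i v s) \<longleftrightarrow> ready s"
  by (auto simp: ready_def)

text \<open>On paths the arbitrary choices become canonical: the only decision state is the terminal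
  vertex, and a chain filling the fiber starts at its initial vertex.\<close>

lemma walked_ready:
  assumes w: "walked nS s" and paths: "\<forall>j<nS. simple_path_graph (fiber T j) (hold_graph T j)"
  shows "ready s"
  unfolding ready_def
proof (intro conjI allI impI)
  show s: "scanned nQ s"
    using w by (simp add: walked_def)
  fix j assume j: "j < nS"
  then have path: "simple_path_graph (fiber T j) (hold_graph T j)"
    using paths by simp
  show t: "terminal T j < nQ"
    using terminal_in_fiber[OF path] by (simp add: fiber_def)
  have "(arrs s ''term'' j = 0 \<and> (\<forall>q<nQ. vis T q = j \<longrightarrow> forced_hold T q)) \<or>
     (\<exists>q<nQ. arrs s ''term'' j = Suc q \<and> vis T q = j \<and> \<not> forced_hold T q)"
    using s by (simp add: scanned_def terms_def)
  moreover have "\<not> (\<forall>q<nQ. vis T q = j \<longrightarrow> forced_hold T q)"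
    using terminal_in_fiber[OF path] terminal_not_forced_hold[OF path] by (auto simp: fiber_def)
  ultimately obtain q where q: "q < nQ" "arrs s ''term'' j = Suc q" "vis T q = j" "\<not> forced_hold T q"
    by blast
  then have "q = terminal T j"
    by (intro terminal_unique[OF path]) (simp_all add: fiber_def)
  then show "arrs s ''term'' j = Suc (terminal T j)"
    using q by simp
  obtain vs where vs: "maximal_chain j vs" "arrs s ''d'' j = length vs"
      "vs \<noteq> [] \<longrightarrow> arrs s ''ent'' j = Suc (hd vs)"
    using w j by (auto simp: walked_def)
  then have len: "length vs = card (fiber T j)"
    using maximal_chain_path_iff(1)[OF _ vs(1)] j path by simp
  have full: "vs \<noteq> []" "hold_chain j vs" "set vs = fiber T j"
    using maximal_chain_path_iff(2)[OF _ vs(1) len] j by simp_all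
  show "arrs s ''ent'' j = Suc (entry T j)" "arrs s ''d'' j = card (fiber T j)"
    using vs len full by (simp_all add: entry_eq_hd[OF full])
  show "arrs s ''label'' j = j"
    using w j by (simp add: walked_def)
qed

text \<open>A flat index instead of a pair of state and input makes the filled part of the table an
  initial segment, even within a row.\<close>

definition target :: "nat \<Rightarrow> nat" where
  "target x = trans T (terminal T (x div nO)) (x mod nO)"

definition emitted :: "nat \<Rightarrow> nat \<Rightarrow> store \<Rightarrow> bool" where
  "emitted n k s \<longleftrightarrow> ready s \<and> regs s ''k'' = k \<and> regs s ''s0'' = vis T (init T) \<and>
     (\<forall>x<k. arrs s ''g'' x = vis T (target x)) \<and>
     edge_list (arrs s ''src'') (arrs s ''dst'') (regs s ''nE'') =
       (\<lambda>x. (x div nO, vis T (target x))) ` {..<k} \<union> (\<lambda>i. (i, i)) ` {..<n} \<and>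
     regs s ''answer'' = of_bool (\<forall>x<k. target x = entry T (vis T (target x)))"

text \<open>\<open>Suc i\<close> appears because the self-loop of \<open>i\<close> is appended
  before its row. The budget is 100 per table entry for the earlier phases, plus 30 for each
  position of \<open>g\<close> and for each visible state.\<close>

definition emitting :: "nat \<Rightarrow> nat \<Rightarrow> store \<Rightarrow> bool" where
  "emitting i t s \<longleftrightarrow> emitted (Suc i) (i * nO + regs s ''u'') s \<and> i < nS \<and> regs s ''i'' = i \<and>
     regs s ''u'' \<le> nO \<and> regs s ''r'' = terminal T i * nO + regs s ''u'' \<and>
     t \<le> 100 * (nQ * nO) + 30 * regs s ''k'' + 30 * i + 50"

definition emit_inv :: "nat \<Rightarrow> store \<Rightarrow> bool" where
  "emit_inv t s \<longleftrightarrow> emitted (regs s ''i'') (regs s ''i'' * nO) s \<and> regs s ''i'' \<le> nS \<and>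
     t \<le> 100 * (nQ * nO) + 30 * regs s ''k'' + 30 * regs s ''i'' + 40"

lemma wp_emit_inputs:
  assumes "emitting i t s"
    and Q: "\<And>t s. emitting i t s \<Longrightarrow> regs s ''u'' = nO \<Longrightarrow> Q (Suc t) s"
  shows "wp emit_inputs Q t s"
  unfolding emit_inputs_def
proof (rule wp_While[where I = "emitting i" and m = "\<lambda>s. nO - regs s ''u''"])
  fix t s assume e: "emitting i t s" and "test_val s (Less (Reg ''u'') (Reg ''nO''))"
  then have u: "regs s ''u'' < nO"
    by (auto simp: emitting_def emitted_def ready_def input_facts)
  let ?u = "regs s ''u''"
  let ?y = "target (i * nO + ?u)"
  have x: "(i * nO + ?u) div nO = i" "(i * nO + ?u) mod nO = ?u"
    using u by simp_all
  have i: "i < nS" "terminal T i < nQ"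
    using e by (auto simp: emitting_def emitted_def ready_def)
  have y: "?y < nQ" "vis T ?y < nS"
    using trans_less[OF i(2) u] u by (simp_all add: target_def vis_less)
  have facts: "arrs s ''delta'' (terminal T i * nO + ?u) = ?y"
    "arrs s ''lambda'' ?y = vis T ?y" "arrs s ''ent'' (vis T ?y) = Suc (entry T (vis T ?y))"
    using e u i y by (auto simp: emitting_def emitted_def ready_def input_facts)
      (auto simp: input_facts target_def)
  show "wp (seqs
     [Load ''y'' ''delta'' (Reg ''r''),
      Load ''j'' ''lambda'' (Reg ''y''),
      Store ''g'' (Reg ''k'') (Reg ''j''),
      Store ''src'' (Reg ''nE'') (Reg ''i''),
      Store ''dst'' (Reg ''nE'') (Reg ''j''),
      Succ ''nE'' (Reg ''nE''),
      Succ ''y'' (Reg ''y''),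
      Load ''z'' ''ent'' (Reg ''j''),
      Cond (Equal (Reg ''y'') (Reg ''z'')) Skip (Assign ''answer'' (Const 0)),
      Succ ''r'' (Reg ''r''),
      Succ ''k'' (Reg ''k''),
      Succ ''u'' (Reg ''u'')])
     (\<lambda>t' s'. emitting i t' s' \<and> nO - regs s' ''u'' < nO - regs s ''u'') (Suc t) s"
    using e u by (auto simp: emitting_def emitted_def facts lessThan_Suc less_Suc_eq x)
next
  fix t s assume "emitting i t s" "\<not> test_val s (Less (Reg ''u'') (Reg ''nO''))"
  then show "Q (Suc t) s"
    by (intro Q) (auto simp: emitting_def emitted_def ready_def input_facts)
qed fact

lemma wp_emit_state:
  assumes I: "emit_inv t s" and i: "regs s ''i'' < nS"
    and Q: "\<And>t' s'. emit_inv t' s' \<Longrightarrow> regs s' ''i'' = Suc (regs s ''i'') \<Longrightarrow> Q t' s'"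
  shows "wp emit_state Q (Suc t) s"
proof -
  let ?i = "regs s ''i''"
  have inputs: "wp emit_inputs (wp (Seq (Succ ''i'' (Reg ''i'')) Skip) Q) t' s'"
    if "emitting ?i t' s'" for t' s'
    using that
  proof (rule wp_emit_inputs)
    fix t s assume "emitting ?i t s" "regs s ''u'' = nO"
    then show "wp (Seq (Succ ''i'' (Reg ''i'')) Skip) Q (Suc t) s"
      by (auto simp: emitting_def emit_inv_def emitted_def add.commute intro!: Q)
  qed
  have "arrs s ''term'' ?i = Suc (terminal T ?i)" "terminal T ?i < nQ" "rows nQ (arrs s ''row'')"
    using I i by (auto simp: emit_inv_def emitted_def ready_def scanned_def)
  then have facts: "arrs s ''term'' ?i = Suc (terminal T ?i)"
      "arrs s ''row'' (Suc (terminal T ?i)) = terminal T ?i * nO"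
    by (auto simp: rows_def)
  show ?thesis
    using I i unfolding emit_state_def
    by (auto simp: facts emit_inv_def emitting_def emitted_def lessThan_Suc intro!: inputs)
qed

lemma wp_emit:
  assumes s: "ready s" "t \<le> 100 * (nQ * nO) + 30"
    and Q: "\<And>t s. emitted nS (nS * nO) s \<Longrightarrow> t \<le> 200 * (nQ * nO) + 100 \<Longrightarrow> Q t s"
  shows "wp emit Q t s"
proof -
  have loop: "wp (While (Less (Reg ''i'') (Reg ''nS'')) emit_state) Q' t' s'"
    if "emit_inv t' s'"
      "\<And>t s. emit_inv t s \<Longrightarrow> regs s ''i'' = nS \<Longrightarrow> Q' (Suc t) s" for t' s' Q'
  proof (rule wp_While[where I = emit_inv and m = "\<lambda>s. nS - regs s ''i''"])
    fix t s assume I: "emit_inv t s" and "test_val s (Less (Reg ''i'') (Reg ''nS''))"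
    then have i: "regs s ''i'' < nS"
      by (auto simp: emit_inv_def emitted_def ready_def input_facts)
    show "wp emit_state (\<lambda>t' s'. emit_inv t' s' \<and> nS - regs s' ''i'' < nS - regs s ''i'') (Suc t) s"
      using i by (intro wp_emit_state[OF I i]) auto
  next
    fix t s assume "emit_inv t s" "\<not> test_val s (Less (Reg ''i'') (Reg ''nS''))"
    then show "Q' (Suc t) s"
      by (intro that(2)) (auto simp: emit_inv_def emitted_def ready_def input_facts)
  qed fact
  have final: "Q (Suc (Suc t)) s" if "emit_inv t s" "regs s ''i'' = nS" for t s
  proof (rule Q)
    show "emitted nS (nS * nO) s"
      using that by (simp add: emit_inv_def)
    \<comment> \<open>Visible labels are attained by control states, so work per visible state fits
      into the budget for control states.\<close>
    have "nS * nO \<le> nQ * nO" "nS \<le> nQ * nO"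
      using nS_le nO_pos by (simp_all add: le_trans[OF nS_le])
    moreover have "t \<le> 100 * (nQ * nO) + 30 * (nS * nO) + 30 * nS + 40"
      using that by (simp add: emit_inv_def emitted_def)
    ultimately show "Suc (Suc t) \<le> 200 * (nQ * nO) + 100"
      by linarith
  qed
  have "arrs s ''lambda'' (init T) = vis T (init T)" "regs s ''q0'' = init T"
    using s init_in by (auto simp: ready_def input_facts)
  then show ?thesis
    using s unfolding emit_def
    by (auto simp: emit_inv_def emitted_def intro!: loop final)
qed

text \<open>With all fibers paths only reset-on-decision remains, and the flat indices below
  \<open>nS * nO\<close> run through all pairs of visible state and input.\<close>

lemma fiber_linear_iff_target:
  assumes "\<forall>j<nS. simple_path_graph (fiber T j) (hold_graph T j)" "\<forall>j<nS. terminal T j < nQ"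
  shows "fiber_linear T \<longleftrightarrow> (\<forall>x<nS * nO. target x = entry T (vis T (target x)))"
proof
  assume f: "fiber_linear T"
  show "\<forall>x<nS * nO. target x = entry T (vis T (target x))"
  proof (intro allI impI)
    fix x assume "x < nS * nO"
    then have x: "x div nO < nS" "x mod nO < nO"
      using nO_pos by (simp_all add: less_mult_imp_div_less)
    then have "vis T (target x) < nS"
      using assms(2) by (simp add: target_def trans_less vis_less)
    then show "target x = entry T (vis T (target x))"
      using f x unfolding fiber_linear_def target_def by simp
  qed
next
  assume t: "\<forall>x<nS * nO. target x = entry T (vis T (target x))"
  have "trans T (terminal T i) u = entry T (vis T (trans T (terminal T i) u))"
    if "i < nS" "u < nO" for i u
    using t[rule_format, OF row_major_less[OF that]] that by (simp add: target_def)
  then show "fiber_linear T"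
    using assms(1) unfolding fiber_linear_def by simp
qed

text \<open>The identity is the relabeling. Edges are compared as sets, so repetitions in the
  emitted list vanish; division and remainder recover the pair behind a flat index.\<close>

lemma output_relabeling:
  assumes "emitted nS (nS * nO) s"
  shows "injective_relabeling (inputs T) (reconstruct T) (output_system s)"
proof -
  have s: "regs s ''nS'' = nS" "regs s ''nO'' = nO" "regs s ''s0'' = vis T (init T)"
    and terminal: "\<And>i. i < nS \<Longrightarrow> terminal T i < nQ"
    and arrays: "\<And>i. i < nS \<Longrightarrow> arrs s ''label'' i = i"
      "\<And>i. i < nS \<Longrightarrow> arrs s ''d'' i = card (fiber T i)"
    using assms by (auto simp: emitted_def ready_def input_facts)
  have g: "arrs s ''g'' (i * nO + u) = vis T (trans T (terminal T i) u)" if "i < nS" "u < nO" for i u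
    using assms row_major_less[OF that] that by (simp add: emitted_def target_def)
  have "edges (output_system s) = edge_list (arrs s ''src'') (arrs s ''dst'') (regs s ''nE'')"
    by (auto simp: output_system_def edge_list_def)
  also have "\<dots> = (\<lambda>x. (x div nO, vis T (target x))) ` {..<nS * nO} \<union> (\<lambda>i. (i, i)) ` {..<nS}"
    using assms by (simp add: emitted_def)
  also have "(\<lambda>x. (x div nO, vis T (target x))) ` {..<nS * nO} =
      {(i, j). i < nS \<and> j < nS \<and> (\<exists>u<nO. vis T (trans T (terminal T i) u) = j)}"
  proof (intro set_eqI iffI; clarify)
    fix i j x assume "x < nS * nO"
    then have "x div nO < nS" "x mod nO < nO"
      using nO_pos by (simp_all add: less_mult_imp_div_less)
    then show "x div nO < nS \<and> vis T (target x) < nS \<and>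
        (\<exists>u<nO. vis T (trans T (terminal T (x div nO)) u) = vis T (target x))"
      using terminal by (auto simp: target_def trans_less vis_less)
  next
    fix i u assume "i < nS" "u < nO"
    then show "(i, vis T (trans T (terminal T i) u)) \<in>
        (\<lambda>x. (x div nO, vis T (target x))) ` {..<nS * nO}"
      using row_major_less by (intro image_eqI[of _ _ "i * nO + u"]) (simp_all add: target_def)
  qed
  also have "\<dots> \<union> (\<lambda>i. (i, i)) ` {..<nS} = edges (reconstruct T)"
    by (auto simp: reconstruct_def)
  finally have edges: "edges (output_system s) = edges (reconstruct T)" .
  show ?thesis
    unfolding injective_relabeling_def edges
    using s arrays g
    by (auto simp: output_system_def reconstruct_def injectively_labeled_def inj_on_def bij_betw_def
        visible_eq[symmetric] intro!: exI[of _ id])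
qed

lemma scanned_input_store: "scanned 0 (input_store T)"
  using row_major_less by (simp add: scanned_def input_in_def input_store_def)

text \<open>No additive constant is left in the bound because \<open>nQ * nO\<close> is at least 1:
  the longer branch takes at most \<open>200 * (nQ * nO) + 101\<close> steps, and 400 leaves
  room.\<close>

lemma decide_correct:
  "\<exists>t s. runs decide (input_store T) t s \<and> t \<le> 400 * (nQ * nO) \<and>
     (answers_yes s \<longleftrightarrow> fiber_linear T) \<and>
     (fiber_linear T \<longrightarrow> injective_relabeling (inputs T) (reconstruct T) (output_system s))"
proof -
  define Q where "Q = (\<lambda>t s. t \<le> 400 * (nQ * nO) \<and> (answers_yes s \<longleftrightarrow> fiber_linear T) \<and>
     (fiber_linear T \<longrightarrow> injective_relabeling (inputs T) (reconstruct T) (output_system s)))"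
  have le: "nS \<le> nQ * nO" "nQ \<le> nQ * nO" "1 \<le> nQ * nO"
    using nS_le nO_pos nQ_pos by (simp_all add: le_trans[OF nS_le] Suc_le_eq)
  have tail: "wp (Seq (Cond (Equal (Reg ''total'') (Reg ''nQ'')) emit (Assign ''answer'' (Const 0))) Skip)
      Q (Suc (Suc t)) s" if w: "walk_inv t s" "regs s ''i'' = nS" for t s
  proof -
    have walked: "walked nS s" and total: "regs s ''total'' = (\<Sum>j<nS. arrs s ''d'' j)"
      and nQ: "regs s ''nQ'' = nQ"
      using w by (auto simp: walk_inv_def walked_def input_facts)
    have "t \<le> 10 * (nQ * nO) + 30 * nQ + 15 + 10 * (\<Sum>j<nS. arrs s ''d'' j) + 20 * nS"
      using w by (simp add: walk_inv_def)
    then have t: "t \<le> 100 * (nQ * nO) + 20"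
      using le walked_total_le[OF walked] by linarith
    show ?thesis
    proof (cases "regs s ''total'' = nQ")
      case True
      then have paths: "\<forall>j<nS. simple_path_graph (fiber T j) (hold_graph T j)"
        using walked_total_eq_iff[OF walked] total by simp
      have "wp emit (wp Skip Q) (Suc (Suc (Suc t))) s"
      proof (rule wp_emit[OF walked_ready[OF walked paths]])
        fix t s assume e: "emitted nS (nS * nO) s" and "t \<le> 200 * (nQ * nO) + 100"
        have "answers_yes s \<longleftrightarrow> (\<forall>x<nS * nO. target x = entry T (vis T (target x)))"
          using e by (simp add: emitted_def answers_yes_def)
        also have "\<dots> \<longleftrightarrow> fiber_linear T"
          using e by (intro fiber_linear_iff_target[symmetric] paths) (auto simp: emitted_def ready_def)
        finally have "answers_yes s \<longleftrightarrow> fiber_linear T" .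
        moreover have "Suc t \<le> 400 * (nQ * nO)"
          using le(3) \<open>t \<le> 200 * (nQ * nO) + 100\<close> by linarith
        ultimately show "wp Skip Q t s"
          using output_relabeling[OF e] by (simp add: Q_def)
      qed (use t in simp)
      then show ?thesis
        using True nQ by simp
    next
      case False
      then have "\<not> fiber_linear T"
        using walked_total_eq_iff[OF walked] total by (auto simp: fiber_linear_def)
      moreover have "Suc (Suc (Suc (Suc (Suc t)))) \<le> 400 * (nQ * nO)"
        using le(3) t by linarith
      ultimately show ?thesis
        using False nQ by (simp add: Q_def answers_yes_def)
    qed
  qed
  have "wp decide Q 0 (input_store T)"
    unfolding decide_def
    by (auto intro!: wp_scan[OF scanned_input_store] wp_walk tail simp del: wp_Cond)
  then show ?thesis
    by (auto simp: wp_def Q_def)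
qed

end

theorem theorem6p1:
  shows
    "(\<exists>P c. \<forall>(T :: (nat, nat, nat) transducer) V. graph_respecting V T \<and> numbered T \<longrightarrow>
        (\<exists>t s. runs P (input_store T) t s \<and> t \<le> c * (card (ctrl T) * card (inputs T)) \<and>
               (answers_yes s \<longleftrightarrow> fiber_linear T) \<and>
               (fiber_linear T \<longrightarrow>
                  injective_relabeling (inputs T) (reconstruct T) (output_system s))))
     \<and>
     (\<forall>(T :: ('q, 'o, 's) transducer) V. graph_respecting V T \<and> fiber_linear T \<longrightarrow>
        symbolic_dlsl (inputs T) (reconstruct T) \<and>
        injectively_labeled (reconstruct T) \<and>
        edge_reduced (inputs T) (reconstruct T) \<and>
        transducer_iso (phase_expanded (inputs T) (reconstruct T)) (at_entry T) \<and>
        (init T = entry T (vis T (init T)) \<longrightarrow>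
           transducer_iso (phase_expanded (inputs T) (reconstruct T)) T) \<and>
        (\<forall>A :: ('s, 'o, 'l) dlsl.
           symbolic_dlsl (inputs T) A \<and> injectively_labeled A \<and>
           (transducer_iso (phase_expanded (inputs T) A) T \<or>
            transducer_iso (phase_expanded (inputs T) A) (at_entry T)) \<longrightarrow>
           injective_relabeling (inputs T) (reconstruct T) (prune (inputs T) A)))"
proof (rule conjI[OF exI[of _ decide, OF exI[of _ 400]]]; rule allI; rule allI; rule impI)
  fix T :: "(nat, nat, nat) transducer" and V
  assume "graph_respecting V T \<and> numbered T"
  then interpret numbered_transducer V T
    by unfold_locales simp_all
  show "\<exists>t s. runs decide (input_store T) t s \<and> t \<le> 400 * (card (ctrl T) * card (inputs T)) \<and>
       (answers_yes s \<longleftrightarrow> fiber_linear T) \<and>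
       (fiber_linear T \<longrightarrow> injective_relabeling (inputs T) (reconstruct T) (output_system s))"
    by (rule decide_correct)
next
  fix T :: "('q, 'o, 's) transducer" and V
  assume "graph_respecting V T \<and> fiber_linear T"
  then interpret fiber_linear_transducer V T
    by unfold_locales simp_all
  have "transducer_iso (phase_expanded (inputs T) (reconstruct T)) T"
    if "init T = entry T (vis T (init T))"
  proof -
    have "at_entry T = T"
      using that by (simp add: at_entry_def)
    with transducer_iso_at_entry show ?thesis
      by (simp only:)
  qed
  moreover have "injective_relabeling (inputs T) (reconstruct T) (prune (inputs T) A)"
    if "symbolic_dlsl (inputs T) A \<and> injectively_labeled A \<and>
       (transducer_iso (phase_expanded (inputs T) A) T \<or>
        transducer_iso (phase_expanded (inputs T) A) (at_entry T))" for A :: "('s, 'o, 'l) dlsl"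
    using that underlying_system_unique by blast
  ultimately show "symbolic_dlsl (inputs T) (reconstruct T) \<and>
        injectively_labeled (reconstruct T) \<and>
        edge_reduced (inputs T) (reconstruct T) \<and>
        transducer_iso (phase_expanded (inputs T) (reconstruct T)) (at_entry T) \<and>
        (init T = entry T (vis T (init T)) \<longrightarrow>
           transducer_iso (phase_expanded (inputs T) (reconstruct T)) T) \<and>
        (\<forall>A :: ('s, 'o, 'l) dlsl.
           symbolic_dlsl (inputs T) A \<and> injectively_labeled A \<and>
           (transducer_iso (phase_expanded (inputs T) A) T \<or>
            transducer_iso (phase_expanded (inputs T) A) (at_entry T)) \<longrightarrow>
           injective_relabeling (inputs T) (reconstruct T) (prune (inputs T) A))"
    using symbolic_dlsl_reconstruct injectively_labeled_reconstruct edge_reduced_reconstruct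
      transducer_iso_at_entry by blast
qed

end
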